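(* Let $d(7)$ be the side length of the equilateral triangle with all angles $2\pi/7$ in the hyperbolic plane of curvature $-1$, and let $e_{d(7)}(n)$ be the maximum number of touching pairs in a packing of $n$ circles of diameter $d(7)$ in that plane. Then for all $n\ge 1$, \[e_{d(7)}(n)\le \left\lfloor \frac72 n-\sqrt{\frac54 n^2+15n-4}\right\rfloor.\]
   Context: Equivalently, $e_{d}(n)$ is the maximum number of pairs at distance exactly $d$ among $n$ points in the hyperbolic plane with all pairwise distances at least $d$. *)

theory Defs
  imports "HOL-Complex_Analysis.Complex_Analysis"
begin

section \<open>The hyperbolic plane of curvature -1 (Poincare disc model)\<close>

typedef hyp_plane = "ball (0::complex) 1"
  by (rule exI[of _ 0]) simp

text \<open>
  \<^term>\<open>to_origin a\<close> is the chart of the disc model obtained by applying the isometry that moves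
  the point \<open>a\<close> to the origin.
\<close>

definition to_origin :: "hyp_plane \<Rightarrow> hyp_plane \<Rightarrow> complex" where
  "to_origin a z = Moebius_function 0 (Rep_hyp_plane a) (Rep_hyp_plane z)"

lemma norm_Rep_less: "cmod (Rep_hyp_plane a) < 1"
  using Rep_hyp_plane[of a] by simp

lemma norm_to_origin_less: "cmod (to_origin a z) < 1"
  by (simp add: to_origin_def Moebius_function_norm_lt_1 norm_Rep_less)

lemma one_minus_cnj_mult_nonzero:
  assumes "cmod a < 1" "cmod z < 1"
  shows "1 - cnj a * z \<noteq> 0"
proof
  assume "1 - cnj a * z = 0"
  hence "cmod (cnj a * z) = 1" by simp
  hence "cmod a * cmod z = 1" by (simp add: norm_mult)
  moreover have "cmod a * cmod z < 1 * 1"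
    by (rule mult_strict_mono') (use assms in auto)
  ultimately show False by simp
qed

lemma cmod_diff_sq: "(cmod (u - v))\<^sup>2 = (cmod u)\<^sup>2 + (cmod v)\<^sup>2 - 2 * (u \<bullet> v)"
  unfolding cmod_power2 inner_complex_def by (simp add: power2_eq_square algebra_simps)

lemma cmod_one_minus_sq:
  "(cmod (1 - cnj u * v))\<^sup>2 = 1 + (cmod u)\<^sup>2 * (cmod v)\<^sup>2 - 2 * (u \<bullet> v)"
  unfolding cmod_power2 inner_complex_def by (simp add: power2_eq_square algebra_simps)

lemma Moebius_invariance:
  assumes "cmod a < 1" "cmod b < 1" "cmod c < 1"
  shows "cmod (Moebius_function 0 (Moebius_function 0 c a) (Moebius_function 0 c b))
           = cmod (Moebius_function 0 a b)"
proof -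
  define k where "k = 1 - c * cnj c"
  define A where "A = 1 - cnj c * a"
  define B where "B = 1 - cnj c * b"
  have nz: "A \<noteq> 0" "B \<noteq> 0" "1 - cnj a * b \<noteq> 0"
    unfolding A_def B_def using assms one_minus_cnj_mult_nonzero by auto
  have k: "k \<noteq> 0"
    unfolding k_def using one_minus_cnj_mult_nonzero[of c c] assms by (simp add: mult.commute)
  have num: "(b - c) / B - (a - c) / A = k * (b - a) / (A * B)"
    using nz(1,2) by (simp add: divide_simps) (simp add: A_def B_def k_def algebra_simps)
  have den: "1 - cnj ((a - c) / A) * ((b - c) / B) = k * (1 - cnj a * b) / (cnj A * B)"
    using nz(1,2) by (simp add: divide_simps) (simp add: A_def B_def k_def algebra_simps)
  have "Moebius_function 0 (Moebius_function 0 c a) (Moebius_function 0 c b)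
          = ((b - c) / B - (a - c) / A) / (1 - cnj ((a - c) / A) * ((b - c) / B))"
    unfolding Moebius_function_simple A_def B_def ..
  also have "\<dots> = (k * (b - a) / (A * B)) / (k * (1 - cnj a * b) / (cnj A * B))"
    unfolding num den ..
  also have "cmod \<dots> = cmod ((b - a) / (1 - cnj a * b))"
    using nz k by (simp add: norm_divide norm_mult)
  finally show ?thesis by (simp add: Moebius_function_simple)
qed

lemma tanh_artanh_real:
  fixes x :: real
  assumes "\<bar>x\<bar> < 1"
  shows "tanh (artanh x) = x"
proof -
  have *: "exp (- 2 * artanh x) = (1 - x) / (1 + x)"
    using assms by (simp add: artanh_def exp_minus)
  show ?thesis
    using assms unfolding tanh_real_altdef * by (simp add: divide_simps)
qed

lemma cmod_to_origin_swap: "cmod (to_origin a b) = cmod (to_origin b a)"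
proof -
  have "cmod (1 - cnj (Rep_hyp_plane a) * Rep_hyp_plane b) =
        cmod (cnj (1 - cnj (Rep_hyp_plane a) * Rep_hyp_plane b))"
    by (simp only: complex_mod_cnj)
  also have "\<dots> = cmod (1 - cnj (Rep_hyp_plane b) * Rep_hyp_plane a)"
    by (simp add: mult.commute)
  finally show ?thesis
    by (simp add: to_origin_def Moebius_function_simple norm_divide norm_minus_commute)
qed

lemma to_origin_eq_0_iff: "to_origin a b = 0 \<longleftrightarrow> a = b"
  using one_minus_cnj_mult_nonzero[OF norm_Rep_less norm_Rep_less, of a b]
  by (auto simp: to_origin_def Moebius_function_simple Rep_hyp_plane_inject)

lemma to_origin_to_origin:
  "cmod (Moebius_function 0 (to_origin c a) (to_origin c b)) = cmod (to_origin a b)"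
  unfolding to_origin_def by (intro Moebius_invariance norm_Rep_less)

lemma Moebius_norm_sq:
  assumes "cmod u < 1" "cmod v < 1"
  shows "(cmod (Moebius_function 0 u v))\<^sup>2 =
    ((cmod u)\<^sup>2 + (cmod v)\<^sup>2 - 2 * (u \<bullet> v)) / (1 + (cmod u)\<^sup>2 * (cmod v)\<^sup>2 - 2 * (u \<bullet> v))"
  unfolding Moebius_function_simple norm_divide power_divide cmod_diff_sq[of v u] cmod_one_minus_sq
  by (simp add: inner_commute add.commute)

lemma Moebius_norm_le:
  assumes "cmod u < 1" "cmod v < 1"
  shows "cmod (Moebius_function 0 u v) \<le> (cmod u + cmod v) / (1 + cmod u * cmod v)"
proof (rule power2_le_imp_le)
  define r s t where "r = cmod u" and "s = cmod v" and "t = u \<bullet> v"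
  have rs: "0 \<le> r" "r < 1" "0 \<le> s" "s < 1" using assms by (auto simp: r_def s_def)
  have t: "- (r * s) \<le> t" "t \<le> r * s"
    using Cauchy_Schwarz_ineq2[of u v] unfolding r_def s_def t_def by linarith+
  have "r * s < 1 * 1"
    by (rule mult_strict_mono') (use rs in auto)
  hence "0 < (1 - r * s)\<^sup>2" by simp
  also have "\<dots> = 1 + r\<^sup>2 * s\<^sup>2 - 2 * (r * s)" by (simp add: power2_eq_square algebra_simps)
  also have "\<dots> \<le> 1 + r\<^sup>2 * s\<^sup>2 - 2 * t" using t by simp
  finally have den: "0 < 1 + r\<^sup>2 * s\<^sup>2 - 2 * t" .
  have pos: "0 < 1 + r * s" using rs by (simp add: add_pos_nonneg)
  have "0 \<le> 2 * (t + r * s) * ((1 - r\<^sup>2) * (1 - s\<^sup>2))"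
    using t rs by (intro mult_nonneg_nonneg) (auto simp: power_le_one)
  also have "\<dots> = (r + s)\<^sup>2 * (1 + r\<^sup>2 * s\<^sup>2 - 2 * t) - (r\<^sup>2 + s\<^sup>2 - 2 * t) * (1 + r * s)\<^sup>2"
    by (simp add: power2_eq_square algebra_simps)
  finally have "(r\<^sup>2 + s\<^sup>2 - 2 * t) / (1 + r\<^sup>2 * s\<^sup>2 - 2 * t) \<le> (r + s)\<^sup>2 / (1 + r * s)\<^sup>2"
    using den pos by (simp add: frac_le_eq divide_le_0_iff)
  thus "(cmod (Moebius_function 0 u v))\<^sup>2 \<le> ((cmod u + cmod v) / (1 + cmod u * cmod v))\<^sup>2"
    unfolding Moebius_norm_sq[OF assms] power_divide by (simp add: r_def s_def t_def)
qed simp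

text \<open>
  The distance is the one induced by the Riemannian metric \<open>4 |dz|\<^sup>2 / (1 - |z|\<^sup>2)\<^sup>2\<close>,
  which has curvature -1.
\<close>

instantiation hyp_plane :: metric_space
begin

definition dist_hyp_plane :: "hyp_plane \<Rightarrow> hyp_plane \<Rightarrow> real" where
  "dist_hyp_plane a b = 2 * artanh (cmod (to_origin a b))"

definition uniformity_hyp_plane :: "(hyp_plane \<times> hyp_plane) filter" where
  "uniformity_hyp_plane = (INF e\<in>{0 <..}. principal {(x, y). dist x y < e})"

definition open_hyp_plane :: "hyp_plane set \<Rightarrow> bool" where
  "open_hyp_plane U = (\<forall>x\<in>U. \<forall>\<^sub>F (x', y) in uniformity. x' = x \<longrightarrow> y \<in> U)"

lemma tanh_half_dist: "tanh (dist a b / 2) = cmod (to_origin a (b::hyp_plane))"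
  using tanh_artanh_real[of "cmod (to_origin a b)"] norm_to_origin_less[of a b]
  by (simp add: dist_hyp_plane_def)

instance
proof
  show "uniformity = (INF e\<in>{0 <..}. principal {(x, y::hyp_plane). dist x y < e})"
    by (simp add: uniformity_hyp_plane_def)
  show "open U = (\<forall>x\<in>U. \<forall>\<^sub>F (x', y) in uniformity. x' = x \<longrightarrow> y \<in> U)" for U :: "hyp_plane set"
    by (simp add: open_hyp_plane_def)
  show "dist x y = 0 \<longleftrightarrow> x = y" for x y :: hyp_plane
  proof -
    have "dist x y = 0 \<longleftrightarrow> tanh (dist x y / 2) = 0" by simp
    thus ?thesis unfolding tanh_half_dist by (simp add: to_origin_eq_0_iff)
  qed
  show "dist x y \<le> dist x z + dist y z" for x y z :: hyp_plane
  proof -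
    have "tanh (dist x y / 2) = cmod (Moebius_function 0 (to_origin z x) (to_origin z y))"
      by (simp add: tanh_half_dist to_origin_to_origin)
    also have "\<dots> \<le> (cmod (to_origin z x) + cmod (to_origin z y)) /
                      (1 + cmod (to_origin z x) * cmod (to_origin z y))"
      by (intro Moebius_norm_le norm_to_origin_less)
    also have "\<dots> = tanh (dist x z / 2 + dist y z / 2)"
      by (subst tanh_add) (simp_all add: tanh_half_dist cmod_to_origin_swap[of _ z])
    finally show ?thesis by simp
  qed
qed

end

text \<open>
  The disc model is conformal and the geodesics through its origin are Euclidean segments, so an
  angle at the origin is the Euclidean angle between position vectors; the vertex is \<open>c\<close>.
\<close>

definition hyp_angle :: "hyp_plane \<Rightarrow> hyp_plane \<Rightarrow> hyp_plane \<Rightarrow> real" where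
  "hyp_angle a c b =
     arccos ((to_origin c a \<bullet> to_origin c b) / (norm (to_origin c a) * norm (to_origin c b)))"

definition equilateral_triangle ::
    "real \<Rightarrow> real \<Rightarrow> hyp_plane \<Rightarrow> hyp_plane \<Rightarrow> hyp_plane \<Rightarrow> bool" where
  "equilateral_triangle s \<alpha> a b c \<longleftrightarrow>
     s > 0 \<and> dist a b = s \<and> dist b c = s \<and> dist c a = s \<and>
     hyp_angle c a b = \<alpha> \<and> hyp_angle a b c = \<alpha> \<and> hyp_angle b c a = \<alpha>"

definition equilateral_side :: "real \<Rightarrow> real" where
  "equilateral_side \<alpha> = (THE s. \<exists>a b c. equilateral_triangle s \<alpha> a b c)"


section \<open>Packings of congruent circles\<close>

text \<open>A packing of circles of diameter \<open>\<delta>\<close> is given by the set \<open>S\<close> of their centres.\<close>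

definition circle_packing :: "real \<Rightarrow> 'a::metric_space set \<Rightarrow> bool" where
  "circle_packing \<delta> S \<longleftrightarrow> finite S \<and> disjoint_family_on (\<lambda>p. ball p (\<delta> / 2)) S"

definition touching_pairs :: "real \<Rightarrow> 'a::metric_space set \<Rightarrow> 'a set set" where
  "touching_pairs \<delta> S =
     {{p, q} | p q. p \<in> S \<and> q \<in> S \<and> p \<noteq> q \<and> sphere p (\<delta> / 2) \<inter> sphere q (\<delta> / 2) \<noteq> {}}"

definition max_touching_pairs :: "real \<Rightarrow> nat \<Rightarrow> nat" where
  "max_touching_pairs \<delta> n =
     Max {card (touching_pairs \<delta> S) | S :: hyp_plane set. circle_packing \<delta> S \<and> card S = n}"


section \<open>Well-definedness of the side length\<close>


lemma cosh_eq_tanh_half: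
  fixes x :: real
  shows "cosh x = (1 + (tanh (x / 2))\<^sup>2) / (1 - (tanh (x / 2))\<^sup>2)"
    and "sinh x = 2 * tanh (x / 2) / (1 - (tanh (x / 2))\<^sup>2)"
proof -
  define C S where "C = cosh (x / 2)" and "S = sinh (x / 2)"
  have C: "C \<noteq> 0" by (simp add: C_def)
  have 1: "C\<^sup>2 - S\<^sup>2 = 1" by (simp add: C_def S_def cosh_square_eq)
  have 2: "1 - (S / C)\<^sup>2 = 1 / C\<^sup>2"
    using C 1 by (simp add: power_divide diff_divide_eq_iff)
  have "cosh x = C\<^sup>2 + S\<^sup>2"
    using cosh_double[of "x / 2"] by (simp add: C_def S_def)
  also have "\<dots> = (1 + (S / C)\<^sup>2) / (1 / C\<^sup>2)"
    using C by (simp add: power_divide algebra_simps)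
  finally show "cosh x = (1 + (tanh (x / 2))\<^sup>2) / (1 - (tanh (x / 2))\<^sup>2)"
    unfolding 2[symmetric] by (simp add: tanh_def C_def S_def)
  have "sinh x = 2 * S * C"
    using sinh_double[of "x / 2"] by (simp add: C_def S_def)
  also have "\<dots> = 2 * (S / C) / (1 / C\<^sup>2)"
    using C by (simp add: power2_eq_square)
  finally show "sinh x = 2 * tanh (x / 2) / (1 - (tanh (x / 2))\<^sup>2)"
    unfolding 2[symmetric] by (simp add: tanh_def C_def S_def)
qed

lemma cosh_dist_to_origin:
  fixes a b c :: hyp_plane
  defines "u \<equiv> to_origin c a" and "v \<equiv> to_origin c b"
  shows "cosh (dist a b) =
    ((1 + (cmod u)\<^sup>2) * (1 + (cmod v)\<^sup>2) - 4 * (u \<bullet> v)) / ((1 - (cmod u)\<^sup>2) * (1 - (cmod v)\<^sup>2))"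
proof -
  define N D where "N = (cmod u)\<^sup>2 + (cmod v)\<^sup>2 - 2 * (u \<bullet> v)"
    and "D = 1 + (cmod u)\<^sup>2 * (cmod v)\<^sup>2 - 2 * (u \<bullet> v)"
  have lt: "cmod u < 1" "cmod v < 1" by (simp_all add: u_def v_def norm_to_origin_less)
  have D: "D \<noteq> 0"
    using one_minus_cnj_mult_nonzero[OF lt] cmod_one_minus_sq[of u v] by (auto simp: D_def)
  have sq: "(tanh (dist a b / 2))\<^sup>2 = N / D"
    using Moebius_norm_sq[OF lt]
    by (simp add: tanh_half_dist to_origin_to_origin N_def D_def u_def v_def)
  have "cosh (dist a b) = (1 + N / D) / (1 - N / D)"
    by (subst cosh_eq_tanh_half) (simp add: sq)
  also have "\<dots> = (D + N) / (D - N)"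
    using D by (simp add: divide_simps)
  also have "D + N = (1 + (cmod u)\<^sup>2) * (1 + (cmod v)\<^sup>2) - 4 * (u \<bullet> v)"
    by (simp add: D_def N_def algebra_simps)
  also have "D - N = (1 - (cmod u)\<^sup>2) * (1 - (cmod v)\<^sup>2)"
    by (simp add: D_def N_def algebra_simps)
  finally show ?thesis .
qed

theorem hyperbolic_law_of_cosines:
  fixes a b c :: hyp_plane
  assumes "a \<noteq> c" "b \<noteq> c"
  shows "cosh (dist a b) =
    cosh (dist a c) * cosh (dist b c) - sinh (dist a c) * sinh (dist b c) * cos (hyp_angle a c b)"
proof -
  define u v where "u = to_origin c a" and "v = to_origin c b"
  have nz: "u \<noteq> 0" "v \<noteq> 0" using assms by (auto simp: u_def v_def to_origin_eq_0_iff)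
  have "\<bar>(u \<bullet> v) / (norm u * norm v)\<bar> \<le> 1"
    using Cauchy_Schwarz_ineq2[of u v] nz by (simp add: divide_simps abs_mult)
  hence "cos (hyp_angle a c b) = (u \<bullet> v) / (norm u * norm v)"
    by (simp add: hyp_angle_def u_def v_def cos_arccos_abs)
  moreover have "tanh (dist a c / 2) = norm u" "tanh (dist b c / 2) = norm v"
    by (simp_all add: tanh_half_dist u_def v_def cmod_to_origin_swap[of _ c])
  ultimately show ?thesis
    using nz unfolding cosh_dist_to_origin[of a b c, folded u_def v_def]
      cosh_eq_tanh_half[of "dist a c"] cosh_eq_tanh_half[of "dist b c"]
    by (simp add: diff_divide_distrib)
qed

definition from_origin :: "hyp_plane \<Rightarrow> complex \<Rightarrow> hyp_plane" where
  "from_origin a v = Abs_hyp_plane (Moebius_function 0 (- Rep_hyp_plane a) v)"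

lemma to_origin_from_origin:
  assumes "cmod v < 1"
  shows "to_origin a (from_origin a v) = v"
proof -
  have "Rep_hyp_plane (from_origin a v) = Moebius_function 0 (- Rep_hyp_plane a) v"
    unfolding from_origin_def
    by (rule Abs_hyp_plane_inverse) (simp add: Moebius_function_norm_lt_1 norm_Rep_less assms)
  thus ?thesis
    by (simp add: to_origin_def Moebius_function_compose norm_Rep_less assms)
qed

lemma cosh_eq_cosh_nonneg:
  fixes x y :: real
  assumes "cosh x = cosh y" "0 \<le> x" "0 \<le> y"
  shows "x = y"
  using assms cosh_real_nonneg_le_iff[of x y] cosh_real_nonneg_le_iff[of y x] by simp


lemma hyp_angle_bounds: "0 \<le> hyp_angle a c b" "hyp_angle a c b \<le> pi"
proof -
  have "\<bar>(to_origin c a \<bullet> to_origin c b) / (norm (to_origin c a) * norm (to_origin c b))\<bar> \<le> 1"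
    using Cauchy_Schwarz_ineq2[of "to_origin c a" "to_origin c b"]
    by (simp add: divide_simps abs_mult)
  thus "0 \<le> hyp_angle a c b" "hyp_angle a c b \<le> pi"
    unfolding hyp_angle_def abs_le_iff by (auto intro!: arccos_lbound arccos_ubound)
qed

lemma equilateral_cosines:
  fixes a b c :: hyp_plane
  assumes "s > 0" "dist a b = s" "dist b c = s" "dist c a = s"
  shows "cosh s * (1 - cos (hyp_angle a b c)) = cos (hyp_angle a b c)"
proof -
  have ne: "a \<noteq> b" "c \<noteq> b" using assms by auto
  have "cosh s = cosh s * cosh s - sinh s * sinh s * cos (hyp_angle a b c)"
    using hyperbolic_law_of_cosines[OF ne] assms by (simp add: dist_commute)
  also have "sinh s * sinh s = cosh s * cosh s - 1"
    using cosh_square_eq[of s] by (simp add: power2_eq_square)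
  finally have "(cosh s - 1) * (cosh s * (1 - cos (hyp_angle a b c)) - cos (hyp_angle a b c)) = 0"
    by (simp add: algebra_simps)
  moreover have "cosh s \<noteq> 1" using assms(1) by simp
  ultimately show ?thesis by simp
qed

lemma equilateral_triangle_imp_cosh:
  assumes "equilateral_triangle s \<alpha> a b c"
  shows "cosh s = cos \<alpha> / (1 - cos \<alpha>)"
proof -
  have *: "cosh s * (1 - cos \<alpha>) = cos \<alpha>"
    using equilateral_cosines[of s a b c] assms by (simp add: equilateral_triangle_def)
  hence "cos \<alpha> \<noteq> 1" by auto
  with * show ?thesis by (simp add: field_simps)
qed

lemma equilateral_triangle_exists:
  assumes "0 < \<alpha>" "\<alpha> < pi / 3"
  shows "\<exists>a b c. equilateral_triangle (arcosh (cos \<alpha> / (1 - cos \<alpha>))) \<alpha> a b c"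
proof -
  define C where "C = cos \<alpha> / (1 - cos \<alpha>)"
  define s where "s = arcosh C"
  have "cos \<alpha> > cos (pi / 3)"
    using assms by (intro cos_monotone_0_pi) auto
  hence c: "cos \<alpha> > 1 / 2" by (simp add: cos_60)
  have c1: "cos \<alpha> < 1"
    using cos_monotone_0_pi[of 0 \<alpha>] assms by simp
  have C: "C > 1" using c c1 by (simp add: C_def field_simps)
  have Cc: "C * (1 - cos \<alpha>) = cos \<alpha>" using c1 by (simp add: C_def)
  have "s \<ge> 0" and s1: "cosh s = C" using C by (simp_all add: s_def)
  moreover have "s \<noteq> 0" using s1 C by auto
  ultimately have s: "cosh s = C" "s > 0" by simp_all
  define o' where "o' = Abs_hyp_plane 0"
  have o': "to_origin o' z = Rep_hyp_plane z" for z
    by (simp add: to_origin_def o'_def Moebius_function_simple Abs_hyp_plane_inverse)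
  define r where "r = tanh (s / 2)"
  have r: "0 < r" "r < 1" using s by (simp_all add: r_def tanh_real_lt_1)
  define b c where "b = Abs_hyp_plane (of_real r)" and "c = Abs_hyp_plane (of_real r * cis \<alpha>)"
  have Rep: "Rep_hyp_plane b = of_real r" "Rep_hyp_plane c = of_real r * cis \<alpha>"
    using r by (simp_all add: b_def c_def Abs_hyp_plane_inverse norm_mult)
  have n: "norm (to_origin o' b) = r" "norm (to_origin o' c) = r"
    using r by (simp_all add: o' Rep norm_mult)
  have ob: "dist o' b = s" and oc: "dist o' c = s"
    using n by (simp_all add: dist_hyp_plane_def r_def artanh_tanh_real)
  have ne: "b \<noteq> o'" "c \<noteq> o'" using ob oc s by auto
  have "(to_origin o' b \<bullet> to_origin o' c) / (norm (to_origin o' b) * norm (to_origin o' c)) = cos \<alpha>"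
    unfolding n using r by (simp add: o' Rep inner_complex_def power2_eq_square)
  hence angle: "hyp_angle b o' c = \<alpha>"
    using assms by (simp add: hyp_angle_def arccos_cos)
  have "cosh (dist b c) = C * C - sinh s * sinh s * cos \<alpha>"
    using hyperbolic_law_of_cosines[OF ne] ob oc s angle by (simp add: dist_commute)
  also have "sinh s * sinh s = C * C - 1"
    using cosh_square_eq[of s] s by (simp add: power2_eq_square)
  also have "C * C - (C * C - 1) * cos \<alpha> = C + (C - 1) * (C * (1 - cos \<alpha>) - cos \<alpha>)"
    by (simp add: algebra_simps)
  finally have cosh_bc: "cosh (dist b c) = cosh s" unfolding Cc s(1) by simp
  have bc: "dist b c = s"
    by (rule cosh_eq_cosh_nonneg[OF cosh_bc]) (use s(2) in simp_all)
  have angle_eq: "hyp_angle x y z = \<alpha>" if "dist x y = s" "dist y z = s" "dist z x = s" for x y z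
  proof -
    have "C * (1 - cos (hyp_angle x y z)) = cos (hyp_angle x y z)"
      using equilateral_cosines[OF s(2) that] unfolding s(1) .
    with Cc have "(C + 1) * (cos (hyp_angle x y z) - cos \<alpha>) = 0" by argo
    hence "cos (hyp_angle x y z) = cos \<alpha>" using C by simp
    thus ?thesis
      using cos_inj_pi[of "hyp_angle x y z" \<alpha>] hyp_angle_bounds[of x y z] assms by simp
  qed
  have "equilateral_triangle s \<alpha> o' b c"
    unfolding equilateral_triangle_def
    by (intro conjI angle_eq) (use ob oc bc s(2) in \<open>simp_all add: dist_commute\<close>)
  thus ?thesis unfolding s_def C_def by blast
qed

theorem equilateral_side_eq:
  assumes "0 < \<alpha>" "\<alpha> < pi / 3"
  shows "equilateral_side \<alpha> = arcosh (cos \<alpha> / (1 - cos \<alpha>))"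
    and "equilateral_side \<alpha> > 0"
    and "\<exists>a b c. equilateral_triangle (equilateral_side \<alpha>) \<alpha> a b c"
proof -
  let ?s = "arcosh (cos \<alpha> / (1 - cos \<alpha>))"
  have ex: "\<exists>a b c. equilateral_triangle ?s \<alpha> a b c"
    by (rule equilateral_triangle_exists[OF assms])
  show eq: "equilateral_side \<alpha> = ?s"
    unfolding equilateral_side_def
  proof (rule the_equality[where P = "\<lambda>s. \<exists>a b c. equilateral_triangle s \<alpha> a b c"])
    fix s assume "\<exists>a b c. equilateral_triangle s \<alpha> a b c"
    then obtain a b c where t: "equilateral_triangle s \<alpha> a b c" by blast
    hence "s \<ge> 0" by (simp add: equilateral_triangle_def)
    thus "s = ?s"
      using equilateral_triangle_imp_cosh[OF t] arcosh_cosh_real[of s] by simp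
  qed (rule ex)
  show "equilateral_side \<alpha> > 0"
    using ex by (auto simp: eq equilateral_triangle_def)
  show "\<exists>a b c. equilateral_triangle (equilateral_side \<alpha>) \<alpha> a b c"
    using ex by (simp only: eq)
qed


section \<open>Packings in terms of distances between centres\<close>

lemma dist_via_origin:
  assumes "cmod u < 1" "cmod v < 1"
  shows "dist (from_origin a u) (from_origin a v) = 2 * artanh (cmod (Moebius_function 0 u v))"
  unfolding dist_hyp_plane_def to_origin_to_origin[of a, symmetric]
  by (simp add: to_origin_from_origin assms)

lemma from_origin_to_origin: "from_origin a (to_origin a b) = b"
proof -
  have "to_origin a (from_origin a (to_origin a b)) = to_origin a b"
    by (simp add: to_origin_from_origin norm_to_origin_less)
  moreover have "Moebius_function 0 (- Rep_hyp_plane a) (Moebius_function 0 (Rep_hyp_plane a) z) = z"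
    if "cmod z < 1" for z
    using that by (intro Moebius_function_compose) (auto simp: norm_Rep_less)
  hence "from_origin a (to_origin a b) = Abs_hyp_plane (Rep_hyp_plane b)"
    by (simp add: from_origin_def to_origin_def norm_Rep_less)
  thus ?thesis by (simp add: Rep_hyp_plane_inverse)
qed

lemma dist_on_line:
  assumes "cmod w = 1"
  shows "dist (from_origin a (of_real (tanh x) * w)) (from_origin a (of_real (tanh y) * w)) =
         2 * \<bar>x - y\<bar>"
proof -
  have ww: "cnj w * w = 1" using assms complex_norm_square[of w] by (simp add: mult.commute)
  have lt: "cmod (of_real (tanh x) * w) < 1" for x
    using assms tanh_real_lt_1[of x] tanh_real_gt_neg1[of x] by (simp add: norm_mult abs_less_iff)
  have "cnj (of_real (tanh x) * w) * (of_real (tanh y) * w) = of_real (tanh x * tanh y) * (cnj w * w)"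
    by simp
  hence "Moebius_function 0 (of_real (tanh x) * w) (of_real (tanh y) * w) =
        of_real (tanh y - tanh x) * w / of_real (1 - tanh x * tanh y)"
    unfolding Moebius_function_simple ww by (simp add: algebra_simps)
  hence "cmod (Moebius_function 0 (of_real (tanh x) * w) (of_real (tanh y) * w)) =
        \<bar>(tanh y - tanh x) / (1 - tanh x * tanh y)\<bar>"
    using assms by (simp only: norm_divide norm_mult norm_of_real abs_divide)
  also have "(tanh y - tanh x) / (1 - tanh x * tanh y) = tanh (y - x)"
    using tanh_add[of y "- x"] by (simp add: mult.commute)
  also have "\<bar>tanh (y - x)\<bar> = tanh \<bar>y - x\<bar>"
    by (rule tanh_real_abs[symmetric])
  finally have *: "cmod (Moebius_function 0 (of_real (tanh x) * w) (of_real (tanh y) * w)) =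
        tanh \<bar>x - y\<bar>"
    by (simp only: abs_minus_commute)
  show ?thesis
    unfolding dist_via_origin[OF lt lt] * artanh_tanh_real ..
qed

lemma hyp_midpoint_exists:
  fixes a b :: hyp_plane
  shows "\<exists>m. dist a m = dist a b / 2 \<and> dist b m = dist a b / 2"
proof (cases "a = b")
  case False
  define v w where "v = to_origin a b" and "w = sgn v"
  have v: "v \<noteq> 0" using False by (simp add: v_def to_origin_eq_0_iff)
  have w: "cmod w = 1" using v by (simp add: w_def norm_sgn)
  define m where "m = from_origin a (of_real (tanh (dist a b / 4)) * w)"
  have "v = of_real (tanh (dist a b / 2)) * w"
    by (simp add: tanh_half_dist w_def v_def[symmetric] sgn_eq v)
  hence b: "b = from_origin a (of_real (tanh (dist a b / 2)) * w)"
    using from_origin_to_origin[of a b] by (simp add: v_def)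
  have "to_origin a a = 0" by (simp add: to_origin_eq_0_iff)
  hence a: "a = from_origin a (of_real (tanh 0) * w)"
    using from_origin_to_origin[of a a] by simp
  have "dist a m = 2 * \<bar>0 - dist a b / 4\<bar>"
    using dist_on_line[OF w, of a 0 "dist a b / 4"] a unfolding m_def by simp
  moreover have "dist b m = 2 * \<bar>dist a b / 2 - dist a b / 4\<bar>"
    using dist_on_line[OF w, of a "dist a b / 2" "dist a b / 4"] b unfolding m_def by simp
  ultimately show ?thesis by (intro exI[of _ m]) simp
qed auto

theorem circle_packing_iff:
  fixes S :: "hyp_plane set"
  shows "circle_packing \<delta> S \<longleftrightarrow> finite S \<and> (\<forall>p\<in>S. \<forall>q\<in>S. p \<noteq> q \<longrightarrow> dist p q \<ge> \<delta>)"
proof -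
  have "ball p (\<delta> / 2) \<inter> ball q (\<delta> / 2) = {} \<longleftrightarrow> dist p q \<ge> \<delta>" for p q :: hyp_plane
  proof
    assume *: "ball p (\<delta> / 2) \<inter> ball q (\<delta> / 2) = {}"
    obtain m where m: "dist p m = dist p q / 2" "dist q m = dist p q / 2"
      using hyp_midpoint_exists by blast
    have "m \<notin> ball p (\<delta> / 2) \<or> m \<notin> ball q (\<delta> / 2)" using * by blast
    thus "dist p q \<ge> \<delta>" by (simp add: m)
  next
    assume *: "dist p q \<ge> \<delta>"
    have "\<not> (dist p x < \<delta> / 2 \<and> dist q x < \<delta> / 2)" for x
      using * dist_triangle2[of p q x] by linarith
    thus "ball p (\<delta> / 2) \<inter> ball q (\<delta> / 2) = {}"
      by auto
  qed
  thus ?thesis by (auto simp: circle_packing_def disjoint_family_on_def)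
qed

theorem touching_pairs_eq:
  fixes S :: "hyp_plane set"
  assumes "circle_packing \<delta> S"
  shows "touching_pairs \<delta> S = {{p, q} | p q. p \<in> S \<and> q \<in> S \<and> p \<noteq> q \<and> dist p q = \<delta>}"
proof -
  have "sphere p (\<delta> / 2) \<inter> sphere q (\<delta> / 2) \<noteq> {} \<longleftrightarrow> dist p q = \<delta>"
    if "p \<in> S" "q \<in> S" "p \<noteq> q" for p q
  proof
    assume "sphere p (\<delta> / 2) \<inter> sphere q (\<delta> / 2) \<noteq> {}"
    then obtain x where "x \<in> sphere p (\<delta> / 2)" "x \<in> sphere q (\<delta> / 2)" by blast
    hence "dist p x = \<delta> / 2" "dist q x = \<delta> / 2" by simp_all
    hence "dist p q \<le> \<delta>" using dist_triangle2[of p q x] by simp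
    moreover have "dist p q \<ge> \<delta>" using assms that unfolding circle_packing_iff by blast
    ultimately show "dist p q = \<delta>" by simp
  next
    assume *: "dist p q = \<delta>"
    obtain m where "dist p m = dist p q / 2" "dist q m = dist p q / 2"
      using hyp_midpoint_exists by blast
    hence "m \<in> sphere p (\<delta> / 2) \<inter> sphere q (\<delta> / 2)" by (simp add: *)
    thus "sphere p (\<delta> / 2) \<inter> sphere q (\<delta> / 2) \<noteq> {}" by blast
  qed
  hence "p \<in> S \<and> q \<in> S \<and> p \<noteq> q \<and> sphere p (\<delta> / 2) \<inter> sphere q (\<delta> / 2) \<noteq> {} \<longleftrightarrow>
        p \<in> S \<and> q \<in> S \<and> p \<noteq> q \<and> dist p q = \<delta>" for p q
    by blast
  thus ?thesis unfolding touching_pairs_def by presburger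
qed

lemma circle_packing_exists:
  assumes "\<delta> > 0"
  shows "\<exists>S :: hyp_plane set. circle_packing \<delta> S \<and> card S = n"
proof -
  define f where "f k = from_origin (Abs_hyp_plane 0) (of_real (tanh (real k * \<delta> / 2)) * 1)" for k :: nat
  have d: "dist (f j) (f k) = \<bar>real j - real k\<bar> * \<delta>" for j k
  proof -
    have "dist (f j) (f k) = 2 * \<bar>real j * \<delta> / 2 - real k * \<delta> / 2\<bar>"
      unfolding f_def by (rule dist_on_line) simp
    also have "real j * \<delta> / 2 - real k * \<delta> / 2 = (real j - real k) * (\<delta> / 2)"
      by (simp add: algebra_simps)
    finally show ?thesis using assms by (simp add: abs_mult)
  qed
  have far: "dist (f j) (f k) \<ge> \<delta>" if "j \<noteq> k" for j k
  proof -
    have "\<bar>real j - real k\<bar> \<ge> 1" using that by linarith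
    thus ?thesis unfolding d using assms by simp
  qed
  have inj: "inj f"
  proof (rule injI, rule ccontr)
    fix j k assume "f j = f k" "j \<noteq> k"
    thus False using far[of j k] assms by simp
  qed
  have "circle_packing \<delta> (f ` {..<n})"
    unfolding circle_packing_iff
  proof (intro conjI ballI impI)
    fix p q assume "p \<in> f ` {..<n}" "q \<in> f ` {..<n}" "p \<noteq> q"
    then obtain j k where "p = f j" "q = f k" "j \<noteq> k" by blast
    thus "\<delta> \<le> dist p q" using far[of j k] by simp
  qed simp
  moreover have "card (f ` {..<n}) = n"
    using inj by (simp add: card_image inj_on_subset)
  ultimately show ?thesis by blast
qed

theorem max_touching_pairs_Max_proper:
  fixes n :: nat
  assumes "\<delta> > 0"
  defines "M \<equiv> {card (touching_pairs \<delta> S) | S :: hyp_plane set. circle_packing \<delta> S \<and> card S = n}"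
  shows "finite M" and "M \<noteq> {}"
proof -
  have "M \<subseteq> {..2 ^ n}"
  proof
    fix m assume "m \<in> M"
    then obtain S :: "hyp_plane set" where S: "finite S" "card S = n" "m = card (touching_pairs \<delta> S)"
      unfolding M_def circle_packing_def by auto
    have "touching_pairs \<delta> S \<subseteq> Pow S" by (auto simp: touching_pairs_def)
    hence "m \<le> card (Pow S)" unfolding S(3) using S(1) by (intro card_mono) auto
    thus "m \<in> {..2 ^ n}" using S by (simp add: card_Pow)
  qed
  thus "finite M" by (rule finite_subset) simp
  show "M \<noteq> {}" using circle_packing_exists[OF assms(1), of n] by (auto simp: M_def)
qed

end

(*
  Lift the points to the hyperboloid in R^3 and triangulate their convex hull by the lower faces of
  generically perturbed lifted points, which gives a Delaunay-like geodesic triangulation.  Contacts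
  are edges of it: the sum of the position vectors of two touching points, viewed as a functional
  through the Lorentz form, is smallest at exactly these two points.

  Let h be the number of points on the boundary, t the number of edges of the triangulation that are
  not contacts, and e the number of contacts.  By Euler's formula e = 3n - 3 - h - t.  Around an
  interior point the angles add up to 2 pi, around a boundary point of degree d to at least
  (d - 1) 2 pi / 7; a triangle has angle sum 6 pi / 7 if its sides are contacts and at most pi
  otherwise.  Comparing, at most 4h - n - 6 + 3t/2 contacts meet the boundary, so by induction
  e <= F(n - h) + 4h - n - 6 + 3t/2 for the bound F of the theorem.  Together with
  e = 3n - 3 - h - t this implies e <= F(n).  The trivial area bound of the non-equilateral triangles
  suffices because every missing edge costs more in Euler's formula than it gains in the angles.
*)

theory Submission
  imports Defs
begin

section \<open>Lifted triangulations\<close>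

text \<open>The contact graph itself may be disconnected and may have cut vertices and faces of any
  length, so neither Euler's formula nor angles along its outer face apply directly. Triangulating
  the whole convex hull gives a boundary on which every vertex starts exactly one boundary edge; the
  price is the edges counted by \<open>t\<close>. The construction is linear: on the hyperboloid,
  geodesics are sections by planes through the origin, so signs of determinants decide all
  incidences, and a supporting plane plays the role of the empty disc of a Delaunay face. Points on
  a common circle would give faces with more than three corners; the perturbation removes these, and
  it must stay below the gap by which a contact functional separates its two points from all others.
  Euler's formula comes from a sweep: every vertex but the rightmost has one more edge than corner
  to its right, every edge has one left end and every triangle one leftmost corner. Angles are kept
  as arguments of complex quotients, so that sums around a vertex telescope.\<close>

type_synonym vec3 = "real \<times> real \<times> real"

text \<open>Supporting functionals are triples as well; quantifiers over them should stay intact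
  under simplification.\<close>

declare split_paired_Ex [simp del] split_paired_All [simp del]

section \<open>Determinants in three dimensions\<close>

fun cross :: "vec3 \<Rightarrow> vec3 \<Rightarrow> vec3" where
  "cross (a, b, c) (a', b', c') = (b * c' - c * b', c * a' - a * c', a * b' - b * a')"

definition det3 :: "vec3 \<Rightarrow> vec3 \<Rightarrow> vec3 \<Rightarrow> real" where
  "det3 u v w = cross u v \<bullet> w"

lemma det3_rotate: "det3 u v w = det3 v w u"
  by (cases u; cases v; cases w) (simp add: det3_def algebra_simps)

lemma det3_swap: "det3 u w v = - det3 u v w"
  by (cases u; cases v; cases w) (simp add: det3_def algebra_simps)

lemma det3_repeat [simp]: "det3 u u w = 0" "det3 u w u = 0" "det3 w u u = 0"
  by (cases u; cases w; simp add: det3_def algebra_simps)+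

text \<open>Cramer's rule for \<open>x\<close> in terms of \<open>u\<close>, \<open>v\<close>,
  \<open>w\<close>, paired with \<open>l\<close> and cleared of the determinant, so it also holds
  for dependent vectors. For \<open>l\<close> vanishing at \<open>u\<close> it is the three-term
  relation behind most orientation arguments below.\<close>

lemma cramer:
  "(l \<bullet> x) * det3 u v w = (l \<bullet> u) * det3 x v w + (l \<bullet> v) * det3 u x w + (l \<bullet> w) * det3 u v x"
proof -
  obtain l1 l2 l3 u1 u2 u3 v1 v2 v3 w1 w2 w3 x1 x2 x3 where
    "l = (l1, l2, l3)" "u = (u1, u2, u3)" "v = (v1, v2, v3)" "w = (w1, w2, w3)" "x = (x1, x2, x3)"
    using prod_cases3 by metis
  thus ?thesis by (simp add: det3_def algebra_simps)
qed

lemma finite_perturbation: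
  fixes f g :: "'a \<Rightarrow> real"
  assumes "finite A" "\<And>x. x \<in> A \<Longrightarrow> f x > 0"
  shows "\<exists>e>0. \<forall>x\<in>A. f x + e * g x > 0"
proof -
  have "\<forall>\<^sub>F e in at_right 0. \<forall>x\<in>A. f x + e * g x > 0"
    unfolding eventually_ball_finite_distrib[OF assms(1)]
  proof
    fix x assume "x \<in> A"
    have "((\<lambda>e. f x + e * g x) \<longlongrightarrow> f x + 0 * g x) (at_right 0)"
      by (intro tendsto_intros)
    thus "\<forall>\<^sub>F e in at_right 0. f x + e * g x > 0"
      by (rule order_tendstoD(1)) (use assms(2)[OF \<open>x \<in> A\<close>] in simp)
  qed
  moreover have "\<forall>\<^sub>F e in at_right 0. (e::real) > 0"
    by (rule eventually_at_right_less)
  ultimately have "\<forall>\<^sub>F e in at_right 0. e > 0 \<and> (\<forall>x\<in>A. f x + e * g x > 0)"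
    by (rule eventually_conj[rotated])
  thus ?thesis
    using eventually_happens'[of "at_right (0::real)"] by auto
qed

text \<open>
  The faces of the lift are the planes \<open>l \<bullet> y = 1\<close> through some of the points \<open>y = P x / c x\<close> with
  all others on the side \<open>l \<bullet> y > 1\<close>; generic weights \<open>c\<close> make all faces triangles. The quotient of \<open>\<rho>\<close> and \<open>\<zeta>\<close> serves as the
  horizontal coordinate of the projected points.
\<close>

locale generic_lift =
  fixes S :: "'p set" and P :: "'p \<Rightarrow> vec3" and c :: "'p \<Rightarrow> real" and \<rho> \<zeta> :: vec3
  assumes finite_S: "finite S"
    and no_four_tight: "\<lbrakk>{u, v, w, x} \<subseteq> S; distinct [u, v, w, x];
      l \<bullet> P u = c u; l \<bullet> P v = c v; l \<bullet> P w = c w\<rbrakk> \<Longrightarrow> l \<bullet> P x \<noteq> c x"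
    and three_tight: "\<lbrakk>{u, v, w} \<subseteq> S; distinct [u, v, w];
      l \<bullet> P u = c u; l \<bullet> P v = c v; l \<bullet> P w = c w\<rbrakk> \<Longrightarrow> det3 (P u) (P v) (P w) \<noteq> 0"
    and vertex_exposed: "v \<in> S \<Longrightarrow> \<exists>l. l \<bullet> P v = c v \<and> (\<forall>x\<in>S - {v}. l \<bullet> P x > c x)"
    and \<zeta>_pos: "x \<in> S \<Longrightarrow> \<zeta> \<bullet> P x > 0"
    and inj_ratio: "inj_on (\<lambda>x. (\<rho> \<bullet> P x) / (\<zeta> \<bullet> P x)) S"
begin

section \<open>Supporting planes, edges and faces\<close>

abbreviation D :: "'p \<Rightarrow> 'p \<Rightarrow> 'p \<Rightarrow> real" where
  "D u v w \<equiv> det3 (P u) (P v) (P w)"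

definition supports :: "vec3 \<Rightarrow> 'p set \<Rightarrow> bool" where
  "supports l A \<longleftrightarrow> A \<subseteq> S \<and> (\<forall>x\<in>A. l \<bullet> P x = c x) \<and> (\<forall>x\<in>S - A. l \<bullet> P x > c x)"

definition edge :: "'p \<Rightarrow> 'p \<Rightarrow> bool" where
  "edge v u \<longleftrightarrow> v \<noteq> u \<and> (\<exists>l. supports l {v, u})"

definition tri :: "'p \<Rightarrow> 'p \<Rightarrow> 'p \<Rightarrow> bool" where
  "tri v u w \<longleftrightarrow> D v u w > 0 \<and> (\<exists>l. supports l {v, u, w})"

lemma edge_sym: "edge v u \<Longrightarrow> edge u v"
  by (auto simp: edge_def insert_commute)

lemma edge_in: "edge v u \<Longrightarrow> v \<in> S \<and> u \<in> S \<and> v \<noteq> u"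
  by (auto simp: edge_def supports_def)

lemma tri_rotate: "tri v u w \<Longrightarrow> tri u w v"
  by (auto simp: tri_def insert_commute det3_rotate[of "P u"] det3_rotate[of "P w"])

lemma tri_in: "tri v u w \<Longrightarrow> v \<in> S \<and> u \<in> S \<and> w \<in> S \<and> distinct [v, u, w]"
  by (auto simp: tri_def supports_def)

text \<open>Gift wrapping: subtracting multiples of \<open>k\<close> rotates the supporting plane
  about the points of \<open>A\<close> until it first meets further points. Points with
  \<open>k \<bullet> P x \<le> 0\<close> lose no slack, so all new tight points lie on the positive
  side.\<close>

lemma tilt:
  assumes l: "supports l A" and k: "\<And>x. x \<in> A \<Longrightarrow> k \<bullet> P x = 0"
    and ex: "\<exists>x\<in>S. k \<bullet> P x > 0"
  obtains W l' where "W \<noteq> {}" "W \<subseteq> {x \<in> S. k \<bullet> P x > 0}" "supports l' (A \<union> W)"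
proof -
  define Q where "Q = {x \<in> S. k \<bullet> P x > 0}"
  \<comment> \<open>The multiple of \<open>k\<close> at which the plane reaches \<open>x\<close>;
    the rotation stops at the minimum.\<close>
  define f where "f x = (l \<bullet> P x - c x) / (k \<bullet> P x)" for x
  have Q: "finite Q" "Q \<noteq> {}" using finite_S ex by (auto simp: Q_def)
  define s where "s = Min (f ` Q)"
  have s: "s \<le> f x" if "x \<in> Q" for x
    unfolding s_def by (intro Min_le finite_imageI Q imageI that)
  have "s \<in> f ` Q" unfolding s_def by (intro Min_in) (use Q in auto)
  then obtain y where y: "y \<in> Q" "s = f y" by blast
  have "y \<in> S - A" using y k by (force simp: Q_def)
  hence "l \<bullet> P y > c y" using l by (auto simp: supports_def)
  hence s0: "s > 0" using y by (simp add: f_def Q_def)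
  define W where "W = {x \<in> Q. f x = s}"
  define l' where "l' = l - s *\<^sub>R k"
  have l': "l' \<bullet> P x = l \<bullet> P x - s * (k \<bullet> P x)" for x
    by (simp add: l'_def inner_diff_left)
  have AS: "A \<subseteq> S" using l by (simp add: supports_def)
  show ?thesis
  proof
    show "W \<noteq> {}" using y by (auto simp: W_def)
    show "W \<subseteq> {x \<in> S. k \<bullet> P x > 0}" by (auto simp: W_def Q_def)
    show "supports l' (A \<union> W)"
      unfolding supports_def
    proof (intro conjI ballI)
      show "A \<union> W \<subseteq> S" using AS by (auto simp: W_def Q_def)
      fix x assume x: "x \<in> A \<union> W"
      show "l' \<bullet> P x = c x"
      proof (cases "x \<in> A")
        case True
        thus ?thesis using l k by (auto simp: l' supports_def)
      next
        case False
        hence "f x = s" "k \<bullet> P x > 0" using x by (auto simp: W_def Q_def)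
        thus ?thesis by (simp add: l' f_def field_simps)
      qed
    next
      fix x assume x: "x \<in> S - (A \<union> W)"
      hence slack: "l \<bullet> P x > c x" using l by (auto simp: supports_def)
      show "l' \<bullet> P x > c x"
      proof (cases "x \<in> Q")
        case True
        hence "s < f x" using x s[OF True] by (auto simp: W_def)
        moreover have "k \<bullet> P x > 0" using True by (simp add: Q_def)
        ultimately show ?thesis by (simp add: l' f_def field_simps)
      next
        case False
        hence "k \<bullet> P x \<le> 0" using x by (auto simp: Q_def)
        hence "s * (k \<bullet> P x) \<le> 0" using s0 by (simp add: mult_le_0_iff)
        thus ?thesis using slack by (simp add: l')
      qed
    qed
  qed
qed

text \<open>The form \<open>cross (P v) (P u)\<close> vanishes at \<open>v\<close> and
  \<open>u\<close> and is positive at \<open>w\<close>. Adding a small multiple of it to the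
  functional of the face releases \<open>w\<close>, and the finitely many other points keep positive
  slack.\<close>

lemma tri_edge:
  assumes t: "tri v u w" shows "edge v u"
proof -
  obtain l where l: "supports l {v, u, w}" and pos: "D v u w > 0" using t by (auto simp: tri_def)
  have in_S: "v \<in> S" "u \<in> S" "w \<in> S" "v \<noteq> u" "v \<noteq> w" "u \<noteq> w" using tri_in[OF t] by auto
  have "\<exists>e>0. \<forall>x\<in>S - {v, u, w}. (l \<bullet> P x - c x) + e * D v u x > 0"
    by (rule finite_perturbation) (use finite_S l in \<open>auto simp: supports_def\<close>)
  then obtain e where e: "e > 0" "\<And>x. x \<in> S - {v, u, w} \<Longrightarrow> (l \<bullet> P x - c x) + e * D v u x > 0"
    by blast
  define l' where "l' = l + e *\<^sub>R cross (P v) (P u)"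
  have l': "l' \<bullet> P x = l \<bullet> P x + e * D v u x" for x
    by (simp add: l'_def det3_def inner_add_left)
  have "supports l' {v, u}"
    unfolding supports_def
  proof (intro conjI ballI)
    fix x assume x: "x \<in> S - {v, u}"
    show "l' \<bullet> P x > c x"
    proof (cases "x = w")
      case True
      have "l \<bullet> P w = c w" using l by (simp add: supports_def)
      thus ?thesis using e(1) pos by (simp add: l' True)
    next
      case False
      thus ?thesis using e(2)[of x] x by (simp add: l')
    qed
  qed (use in_S l in \<open>auto simp: l' supports_def\<close>)
  thus ?thesis using in_S by (auto simp: edge_def)
qed

lemma tri_edges: "tri v u w \<Longrightarrow> edge v u \<and> edge u w \<and> edge w v \<and> edge u v \<and> edge w u \<and> edge v w"
  using tri_edge tri_rotate edge_sym by blast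

text \<open>Tilting the plane of the edge to the left reaches just one new point, since no
  functional is tight at four.\<close>

lemma left_triangle_exists:
  assumes "edge v u" "x \<in> S" "D v u x > 0"
  shows "\<exists>w. tri v u w"
proof -
  obtain l where l: "supports l {v, u}" using assms by (auto simp: edge_def)
  have vu: "v \<in> S" "u \<in> S" "v \<noteq> u" using edge_in assms by auto
  obtain W l' where W: "W \<noteq> {}" "W \<subseteq> {x \<in> S. cross (P v) (P u) \<bullet> P x > 0}"
    and l': "supports l' ({v, u} \<union> W)"
    by (rule tilt[OF l, of "cross (P v) (P u)"]) (use assms in \<open>auto simp: det3_def[symmetric]\<close>)
  obtain w where w: "w \<in> W" using W by blast
  have Dpos: "D v u y > 0 \<and> y \<in> S" if "y \<in> W" for y using W that by (auto simp: det3_def)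
  have "W = {w}"
  proof (rule ccontr)
    assume "W \<noteq> {w}"
    then obtain y where y: "y \<in> W" "y \<noteq> w" using w by blast
    have "distinct [v, u, w, y]" using vu y Dpos[OF w] Dpos[OF y(1)] by auto
    thus False using no_four_tight[of v u w y l'] l' w y vu Dpos by (auto simp: supports_def)
  qed
  hence "supports l' {v, u, w}" using l' by (simp add: insert_commute)
  thus ?thesis using Dpos[OF w] by (auto simp: tri_def)
qed

text \<open>The difference of the two functionals vanishes at \<open>v\<close> and \<open>u\<close>,
  so it has one sign on the left of the edge; but slack makes it positive at \<open>w\<close> and
  negative at \<open>w'\<close>.\<close>

lemma left_triangle_unique:
  assumes "tri v u w" "tri v u w'"
  shows "w = w'"
proof (rule ccontr)
  assume ne: "w \<noteq> w'"
  obtain l l' where l: "supports l {v, u, w}" "supports l' {v, u, w'}" and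
    D: "D v u w > 0" "D v u w' > 0" using assms by (auto simp: tri_def)
  have d: "w \<in> S" "w' \<in> S" "distinct [v, u, w]" "distinct [v, u, w']"
    using tri_in[OF assms(1)] tri_in[OF assms(2)] by auto
  have "(l' - l) \<bullet> P v = 0" "(l' - l) \<bullet> P u = 0" "(l' - l) \<bullet> P w > 0" "(l' - l) \<bullet> P w' < 0"
    using l d ne by (auto simp: supports_def inner_diff_left)
  moreover have "((l' - l) \<bullet> P w') * D v u w = ((l' - l) \<bullet> P w) * D v u w'"
    using cramer[of "l' - l" "P w'" "P v" "P u" "P w"] calculation by simp
  ultimately show False using D by (metis mult_pos_pos mult_neg_pos not_less_iff_gr_or_eq)
qed

text \<open>Tilting from a single vertex may reach two points at once; these form a face with
  \<open>v\<close>, whose sides are edges. This is what makes fans nonempty in the sweep.\<close>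

lemma edge_towards:
  assumes "v \<in> S" "k \<bullet> P v = 0" "x \<in> S" "k \<bullet> P x > 0"
  shows "\<exists>u. edge v u \<and> k \<bullet> P u > 0"
proof -
  obtain l where l: "supports l {v}" using vertex_exposed[OF assms(1)] assms(1) by (auto simp: supports_def)
  obtain W l' where W: "W \<noteq> {}" "W \<subseteq> {x \<in> S. k \<bullet> P x > 0}" and l': "supports l' ({v} \<union> W)"
    by (rule tilt[OF l, of k]) (use assms in auto)
  obtain u where u: "u \<in> W" using W by blast
  have W': "k \<bullet> P y > 0 \<and> y \<in> S \<and> y \<noteq> v" if "y \<in> W" for y using W that assms by auto
  show ?thesis
  proof (cases "W = {u}")
    case True
    thus ?thesis using l' W'[OF u] by (auto simp: edge_def insert_commute)
  next
    case False
    then obtain w where w: "w \<in> W" "w \<noteq> u" using u by blast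
    have d: "distinct [v, u, w]" using W'[OF u] W'[OF w(1)] w by auto
    have tight: "l' \<bullet> P v = c v" "l' \<bullet> P u = c u" "l' \<bullet> P w = c w"
      using l' u w by (auto simp: supports_def)
    have "W \<subseteq> {u, w}"
    proof
      fix y assume y: "y \<in> W"
      show "y \<in> {u, w}"
        using no_four_tight[of v u w y l'] d tight l' y W'[OF y] W'[OF u] W'[OF w(1)] assms(1)
        by (auto simp: supports_def)
    qed
    hence s: "supports l' {v, u, w}" using l' u w by (smt (verit) insert_commute insert_is_Un subset_antisym insert_subset empty_subsetI)
    have "D v u w \<noteq> 0" using three_tight[of v u w l'] d tight W'[OF u] W'[OF w(1)] assms(1) by auto
    hence "tri v u w \<or> tri v w u"
      using s det3_swap[of "P v" "P w" "P u"] by (auto simp: tri_def insert_commute)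
    hence "edge v u" using tri_edges by blast
    thus ?thesis using W'[OF u] by blast
  qed
qed

end

section \<open>Fans of edges in a half-plane\<close>

lemma det3_cross: "det3 v u (cross k v) = (v \<bullet> k) * (u \<bullet> v) - (v \<bullet> v) * (u \<bullet> k)"
  by (cases v; cases u; cases k) (simp add: det3_def algebra_simps)

context generic_lift
begin

text \<open>Within an open half-plane at \<open>v\<close> the relation \<open>D v a b > 0\<close> is
  transitive, which fails on the full circle of directions.\<close>

definition fan :: "vec3 \<Rightarrow> 'p \<Rightarrow> 'p set" where
  "fan k v = {u. edge v u \<and> k \<bullet> P u > 0}"

text \<open>The difference of the two functionals vanishes at \<open>v\<close>, so along one ray it
  cannot change sign, yet it is negative at \<open>u\<close> and positive at
  \<open>u'\<close>.\<close>

lemma edge_same_ray: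
  assumes e: "u \<in> fan k v" "u' \<in> fan k v" and k: "k \<bullet> P v = 0" and D: "D v u u' = 0"
  shows "u = u'"
proof (rule ccontr)
  assume ne: "u \<noteq> u'"
  obtain l l' where l: "supports l {v, u}" "supports l' {v, u'}" using e by (auto simp: fan_def edge_def)
  have d: "v \<noteq> u" "v \<noteq> u'" "u \<in> S" "u' \<in> S" "v \<in> S" using e edge_in by (auto simp: fan_def)
  have kpos: "k \<bullet> P u > 0" "k \<bullet> P u' > 0" using e by (auto simp: fan_def)
  \<comment> \<open>A vector off the plane spanned by \<open>P v\<close> and \<open>P u\<close>. Its
    determinants with \<open>u\<close> and \<open>u'\<close> have the same sign: each is
    \<open>- (P v \<bullet> P v)\<close> times the value of \<open>k\<close> there.\<close>
  define q where "q = cross k (P v)"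
  have vv: "P v \<bullet> P v > 0" using \<zeta>_pos[OF d(5)] by auto
  have B: "det3 (P v) (P u) q < 0" and B': "det3 (P v) (P u') q < 0"
    using k kpos vv by (simp_all add: q_def det3_cross inner_commute)
  define g where "g = l - l'"
  have g: "g \<bullet> P v = 0" "g \<bullet> P u < 0" "g \<bullet> P u' > 0"
    using l d ne by (auto simp: g_def supports_def inner_diff_left)
  have "0 = (g \<bullet> P u) * det3 (P v) q (P u') + (g \<bullet> P u') * det3 (P v) (P u) q"
    using cramer[of g q "P v" "P u" "P u'"] D g(1) by simp
  also have "\<dots> = (g \<bullet> P u) * (- det3 (P v) (P u') q) + (g \<bullet> P u') * det3 (P v) (P u) q"
    by (simp add: det3_swap[of "P v" q])
  also have "\<dots> < 0"
    using g B B' by (intro add_neg_neg mult_neg_pos mult_pos_neg) auto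
  finally show False by simp
qed

lemma fan_plucker:
  assumes "k \<bullet> P v = 0"
  shows "(k \<bullet> P b) * D v a d = (k \<bullet> P a) * D v b d + (k \<bullet> P d) * D v a b"
  using cramer[of k "P b" "P v" "P a" "P d"] assms by simp

text \<open>Otherwise \<open>u'\<close> lies inside the angle of the face at \<open>v\<close>, and
  the edge to \<open>u'\<close> would cut through the face. The contradiction is in
  \<open>g\<close>, which vanishes at \<open>v\<close>, is positive at \<open>u\<close> and
  \<open>w\<close>, but negative at \<open>u'\<close>, a positive combination of \<open>u\<close>
  and \<open>w\<close> modulo \<open>v\<close>.\<close>

lemma fan_triangle:
  assumes e: "u \<in> fan k v" "u' \<in> fan k v" and k: "k \<bullet> P v = 0" and D: "D v u u' > 0"
    and t: "tri v u w"
  shows "w \<in> fan k v"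
proof -
  have kpos: "k \<bullet> P u > 0" "k \<bullet> P u' > 0" using e by (auto simp: fan_def)
  have "k \<bullet> P w > 0"
  proof (rule ccontr)
    assume kw: "\<not> k \<bullet> P w > 0"
    obtain l' where l': "supports l' {v, u'}" using e by (auto simp: fan_def edge_def)
    obtain l where l: "supports l {v, u, w}" and Dw: "D v u w > 0" using t by (auto simp: tri_def)
    have "(k \<bullet> P u) * D v u' w = (k \<bullet> P u') * D v u w - (k \<bullet> P w) * D v u u'"
      using fan_plucker[OF k, of u' u w] by simp
    moreover have "(k \<bullet> P w) * D v u u' \<le> 0" using kw D by (simp add: mult_le_0_iff)
    moreover have "(k \<bullet> P u') * D v u w > 0" using kpos Dw by simp
    ultimately have "(k \<bullet> P u) * D v u' w > 0" by linarith
    hence Dw': "D v u' w > 0" using kpos by (simp add: zero_less_mult_iff)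
    have d: "u \<in> S" "u' \<in> S" "v \<in> S" "w \<in> S" "v \<noteq> u" "v \<noteq> u'" "w \<noteq> u'" "u \<noteq> u'" "v \<noteq> w" "u \<noteq> w"
      using e edge_in tri_in[OF t] Dw' D by (auto simp: fan_def)
    define g where "g = l' - l"
    have g: "g \<bullet> P v = 0" "g \<bullet> P u > 0" "g \<bullet> P w > 0" "g \<bullet> P u' < 0"
      using l l' d by (auto simp: g_def supports_def inner_diff_left)
    have "(g \<bullet> P u') * D v u w = (g \<bullet> P u) * D v u' w + (g \<bullet> P w) * D v u u'"
      by (rule fan_plucker[OF g(1)])
    moreover have "(g \<bullet> P u') * D v u w < 0" using g Dw by (simp add: mult_neg_pos)
    moreover have "(g \<bullet> P u) * D v u' w > 0" "(g \<bullet> P w) * D v u u' > 0" using g Dw' D by simp_all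
    ultimately show False by linarith
  qed
  thus ?thesis using tri_edges[OF t] by (simp add: fan_def)
qed

lemma finite_fan: "finite (fan k v)"
  by (rule finite_subset[OF _ finite_S]) (auto simp: fan_def dest: edge_in)

text \<open>
  The only edge of a fan with no fan triangle to its left is the last one in counterclockwise order.
\<close>

lemma card_fan:
  assumes v: "v \<in> S" and k: "k \<bullet> P v = 0" and x: "x \<in> S" "k \<bullet> P x > 0"
  shows "card (fan k v) = card {(u, w). tri v u w \<and> u \<in> fan k v \<and> w \<in> fan k v} + 1"
proof -
  let ?T = "{(u, w). tri v u w \<and> u \<in> fan k v \<and> w \<in> fan k v}"
  let ?R = "\<lambda>a b. D v a b > 0"
  have "fan k v \<noteq> {}" using edge_towards[OF v k x] by (auto simp: fan_def)
  moreover have "asymp_on (fan k v) ?R"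
  proof (rule asymp_onI)
    show "\<not> D v b a > 0" if "D v a b > 0" for a b
      using that det3_swap[of "P v" "P a" "P b"] by simp
  qed
  moreover have "transp_on (fan k v) ?R"
  proof (rule transp_onI)
    fix a b d assume "a \<in> fan k v" "b \<in> fan k v" "d \<in> fan k v" "D v a b > 0" "D v b d > 0"
    hence "k \<bullet> P b > 0" "(k \<bullet> P a) * D v b d + (k \<bullet> P d) * D v a b > 0"
      by (auto simp: fan_def intro!: add_pos_pos)
    thus "D v a d > 0"
      using fan_plucker[OF k, of b a d] zero_less_mult_pos[of "k \<bullet> P b" "D v a d"] by simp
  qed
  ultimately obtain m where m: "m \<in> fan k v" "\<And>u. u \<in> fan k v \<Longrightarrow> u \<noteq> m \<Longrightarrow> \<not> D v m u > 0"
    using Finite_Set.bex_max_element[OF finite_fan, of k v ?R] by metis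
  have "fst ` ?T = fan k v - {m}"
  proof (intro equalityI subsetI)
    fix u assume "u \<in> fst ` ?T"
    then obtain w where w: "tri v u w" "u \<in> fan k v" "w \<in> fan k v" by auto
    have "D v u w > 0" "w \<noteq> u" using w(1) tri_in[OF w(1)] by (auto simp: tri_def)
    thus "u \<in> fan k v - {m}" using m(2)[OF w(3)] w(2) by auto
  next
    fix u assume u: "u \<in> fan k v - {m}"
    have "\<not> D v m u > 0" using m(2) u by blast
    moreover have "D v m u \<noteq> 0" using edge_same_ray[OF m(1) _ k, of u] u by auto
    ultimately have D: "D v u m > 0" using det3_swap[of "P v" "P u" "P m"] by simp
    have "edge v u" "m \<in> S" using u m(1) edge_in by (auto simp: fan_def)
    then obtain w where w: "tri v u w" using left_triangle_exists[OF _ _ D] by blast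
    hence "w \<in> fan k v" using fan_triangle[OF _ m(1) k D w] u by blast
    hence "(u, w) \<in> ?T" using w u by simp
    thus "u \<in> fst ` ?T" by (rule image_eqI[rotated]) simp
  qed
  moreover have "inj_on fst ?T"
    unfolding inj_on_def using left_triangle_unique by fastforce
  ultimately have "card ?T = card (fan k v - {m})"
    using card_image[of fst ?T] by simp
  thus ?thesis using card_Suc_Diff1[OF finite_fan m(1)] by simp
qed

section \<open>Euler's formula by a sweep\<close>

definition darts :: "('p \<times> 'p) set" where "darts = {(v, u). edge v u}"
text \<open>Every edge gives two darts and every face three triples, one per rotation, so each
  corner of a face is the first entry of exactly one triple.\<close>

definition tris :: "('p \<times> 'p \<times> 'p) set" where "tris = {(v, u, w). tri v u w}"

text \<open>The clockwise boundary of the convex hull.\<close>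

definition rim :: "('p \<times> 'p) set" where
  "rim = {(v, u). edge v u \<and> (\<forall>x\<in>S. D v u x \<le> 0)}"

lemma finite_darts: "finite darts"
  by (rule finite_subset[of _ "S \<times> S"]) (use edge_in finite_S in \<open>auto simp: darts_def\<close>)

lemma finite_tris: "finite tris"
  by (rule finite_subset[of _ "S \<times> S \<times> S"]) (use tri_in finite_S in \<open>auto simp: tris_def\<close>)

lemma rim_subset: "rim \<subseteq> darts" by (auto simp: rim_def darts_def)

text \<open>A dart off the rim has a point strictly to its left, hence exactly one face there; a rim
  dart has none.\<close>

lemma card_darts_rim: "card darts = card tris + card rim"
proof -
  have "(\<lambda>(v, u, w). (v, u)) ` tris = darts - rim"
  proof (intro equalityI subsetI)
    fix d assume "d \<in> darts - rim"
    then obtain v u where d: "d = (v, u)" "edge v u" "\<not> (\<forall>x\<in>S. D v u x \<le> 0)"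
      by (auto simp: darts_def rim_def)
    moreover then obtain x where "x \<in> S" "D v u x > 0" by (metis not_le)
    ultimately obtain w where "tri v u w" using left_triangle_exists by blast
    hence "d = (\<lambda>(v, u, w). (v, u)) (v, u, w)" "(v, u, w) \<in> tris"
      using d by (simp_all add: tris_def)
    thus "d \<in> (\<lambda>(v, u, w). (v, u)) ` tris" by (rule image_eqI)
  next
    fix d assume "d \<in> (\<lambda>(v, u, w). (v, u)) ` tris"
    then obtain v u w where t: "d = (v, u)" "tri v u w" by (auto simp: tris_def)
    hence "w \<in> S" "D v u w > 0" using tri_in by (auto simp: tri_def)
    hence "(v, u) \<notin> rim" by (force simp: rim_def)
    thus "d \<in> darts - rim" using t tri_edge by (simp add: darts_def)
  qed
  moreover have "inj_on (\<lambda>(v, u, w). (v, u)) tris"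
  proof (rule inj_onI)
    fix a b assume "a \<in> tris" "b \<in> tris" "(\<lambda>(v, u, w). (v, u)) a = (\<lambda>(v, u, w). (v, u)) b"
    moreover obtain v u w where "a = (v, u, w)" by (cases a)
    moreover obtain v' u' w' where "b = (v', u', w')" by (cases b)
    ultimately show "a = b" using left_triangle_unique[of v u w w'] by (simp add: tris_def)
  qed
  ultimately have "card tris = card (darts - rim)"
    using card_image[of "\<lambda>(v, u, w). (v, u)" tris] by simp
  thus ?thesis
    using card_Diff_subset[OF finite_subset[OF rim_subset finite_darts] rim_subset]
      card_mono[OF finite_darts rim_subset] by simp
qed

definition ratio :: "'p \<Rightarrow> real" where "ratio x = (\<rho> \<bullet> P x) / (\<zeta> \<bullet> P x)"

text \<open>The comparison of ratios with \<open>v\<close>, cleared of denominators: a linear form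
  that vanishes at \<open>v\<close>, so it can serve as the \<open>k\<close> of a fan.\<close>

definition rightward :: "'p \<Rightarrow> vec3" where
  "rightward v = (\<zeta> \<bullet> P v) *\<^sub>R \<rho> - (\<rho> \<bullet> P v) *\<^sub>R \<zeta>"

lemma rightward_self: "rightward v \<bullet> P v = 0"
  by (simp add: rightward_def inner_diff_left)

lemma rightward_pos:
  assumes "v \<in> S" "x \<in> S"
  shows "rightward v \<bullet> P x > 0 \<longleftrightarrow> ratio v < ratio x"
  using \<zeta>_pos[OF assms(1)] \<zeta>_pos[OF assms(2)]
  by (simp add: rightward_def ratio_def inner_diff_left divide_simps) (simp add: mult.commute)

lemma ratio_neq: "v \<in> S \<Longrightarrow> u \<in> S \<Longrightarrow> v \<noteq> u \<Longrightarrow> ratio v \<noteq> ratio u"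
  using inj_ratio by (auto simp: inj_on_def ratio_def)

lemma mem_fan_rightward: "u \<in> fan (rightward v) v \<longleftrightarrow> edge v u \<and> ratio v < ratio u"
  using rightward_pos edge_in by (auto simp: fan_def)

lemma card_darts_fans: "card darts = 2 * (\<Sum>v\<in>S. card (fan (rightward v) v))"
proof -
  define A where "A = Sigma S (\<lambda>v. fan (rightward v) v)"
  have memA: "(v, u) \<in> A \<longleftrightarrow> edge v u \<and> ratio v < ratio u" for v u
    using edge_in by (auto simp: A_def mem_fan_rightward)
  have swapI: "(v, u) \<in> prod.swap ` A \<longleftrightarrow> (u, v) \<in> A" for v u
    by (rule pair_in_swap_image)
  have "edge v u \<longleftrightarrow> edge v u \<and> ratio v < ratio u \<or> edge u v \<and> ratio u < ratio v" for v u
    using ratio_neq[of v u] edge_in[of v u] edge_sym[of u v] edge_sym[of v u] by argo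
  hence "darts = A \<union> prod.swap ` A"
    unfolding set_eq_iff split_paired_All darts_def Un_iff swapI memA by simp
  moreover have "A \<inter> prod.swap ` A = {}"
    unfolding set_eq_iff split_paired_All Int_iff swapI memA by auto
  moreover have fA: "finite A" by (simp add: A_def finite_S finite_fan)
  moreover have "card (prod.swap ` A) = card A" by (rule card_image) simp
  ultimately have "card darts = 2 * card A" by (simp add: card_Un_disjoint)
  thus ?thesis by (simp add: A_def finite_S finite_fan)
qed

text \<open>Exactly one of the three rotations of a face starts at its corner of smallest
  \<open>ratio\<close>, and this is the one whose other corners both lie in the fan.\<close>

lemma card_tris_fans:
  "card tris = 3 * (\<Sum>v\<in>S. card {(u, w). tri v u w \<and> u \<in> fan (rightward v) v \<and> w \<in> fan (rightward v) v})"
proof -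
  define T where "T v = {(u, w). tri v u w \<and> u \<in> fan (rightward v) v \<and> w \<in> fan (rightward v) v}" for v
  define A where "A = Sigma S T"
  define rot where "rot = (\<lambda>(v :: 'p, u :: 'p, w :: 'p). (u, w, v))"
  have memA: "(v, u, w) \<in> A \<longleftrightarrow> tri v u w \<and> ratio v < ratio u \<and> ratio v < ratio w" for v u w
    using tri_in tri_edges by (auto simp: A_def T_def mem_fan_rightward)
  have rotI: "(v, u, w) \<in> rot ` X \<longleftrightarrow> (w, v, u) \<in> X" for v u w and X :: "('p \<times> 'p \<times> 'p) set"
    by (simp add: rot_def image_iff Bex_def split_paired_Ex)
  have "tri v u w \<longleftrightarrow> (v, u, w) \<in> A \<or> (w, v, u) \<in> A \<or> (u, w, v) \<in> A" for v u w
    using ratio_neq[of v u] ratio_neq[of v w] ratio_neq[of u w] tri_in[of v u w]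
      tri_rotate[of v u w] tri_rotate[of u w v] tri_rotate[of w v u]
    unfolding memA by auto
  hence "tris = A \<union> (rot ` A \<union> rot ` rot ` A)"
    unfolding set_eq_iff split_paired_All tris_def Un_iff rotI by simp
  moreover have "A \<inter> (rot ` A \<union> rot ` rot ` A) = {}" "rot ` A \<inter> rot ` rot ` A = {}"
    unfolding set_eq_iff split_paired_All Int_iff Un_iff rotI memA by auto
  moreover have TS: "T v \<subseteq> S \<times> S" for v using tri_in by (auto simp: T_def)
  have finT: "finite (T v)" for v by (rule finite_subset[OF TS]) (simp add: finite_S)
  moreover have fA: "finite A" by (simp add: A_def finite_S finT)
  moreover have "inj rot" by (auto simp: rot_def inj_def)
  hence "card (rot ` X) = card X" for X :: "('p \<times> 'p \<times> 'p) set" by (intro card_image) (rule inj_on_subset, auto)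
  ultimately have "card tris = 3 * card A" by (simp add: card_Un_disjoint)
  thus ?thesis unfolding A_def T_def[symmetric] by (simp add: finite_S finT)
qed

text \<open>Summing \<open>card_fan\<close> over all vertices but the rightmost, whose fan is empty,
  gives edges minus faces equal to \<open>card S - 1\<close>; the factors turn edges and faces into
  darts and rotated triples.\<close>

theorem euler_darts_tris:
  assumes "S \<noteq> {}"
  shows "3 * card darts + 6 = 2 * card tris + 6 * card S"
proof -
  define T where "T v = {(u, w). tri v u w \<and> u \<in> fan (rightward v) v \<and> w \<in> fan (rightward v) v}" for v
  have "Max (ratio ` S) \<in> ratio ` S" using assms finite_S by (intro Max_in) auto
  then obtain m where m: "m \<in> S" "ratio m = Max (ratio ` S)" by auto
  have mmax: "ratio x \<le> ratio m" if "x \<in> S" for x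
    unfolding m(2) using finite_S that by (intro Max_ge) auto
  have fan_m: "fan (rightward m) m = {}"
  proof -
    have "\<not> (edge m u \<and> ratio m < ratio u)" for u
      using mmax[of u] edge_in[of m u] by auto
    thus ?thesis using mem_fan_rightward by blast
  qed
  have "card (fan (rightward v) v) = card (T v) + 1" if "v \<in> S - {m}" for v
  proof -
    have v: "v \<in> S" using that by simp
    have "ratio v < ratio m" using mmax[of v] ratio_neq[of v m] that m by force
    thus ?thesis unfolding T_def
      using card_fan[OF v rightward_self m(1)] rightward_pos[OF v m(1)] by simp
  qed
  hence "(\<Sum>v\<in>S - {m}. card (fan (rightward v) v)) = (\<Sum>v\<in>S - {m}. card (T v) + 1)"
    by (rule sum.cong[OF refl])
  also have "\<dots> = (\<Sum>v\<in>S - {m}. card (T v)) + (card S - 1)"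
    unfolding sum.distrib using m finite_S by simp
  finally have *: "(\<Sum>v\<in>S - {m}. card (fan (rightward v) v)) = (\<Sum>v\<in>S - {m}. card (T v)) + (card S - 1)" .
  have Tm: "T m = {}" using fan_m by (simp add: T_def)
  have "(\<Sum>v\<in>S. card (fan (rightward v) v)) = (\<Sum>v\<in>S. card (T v)) + (card S - 1)"
    unfolding sum.remove[OF finite_S m(1)] * by (simp add: Tm fan_m)
  moreover have "card S \<ge> 1" using assms finite_S by (simp add: Suc_leI card_gt_0_iff)
  moreover have "card tris = 3 * (\<Sum>v\<in>S. card (T v))" unfolding card_tris_fans T_def ..
  ultimately show ?thesis using card_darts_fans by linarith
qed

lemma collinear_tris_empty:
  assumes "\<And>x y z. x \<in> S \<Longrightarrow> y \<in> S \<Longrightarrow> z \<in> S \<Longrightarrow> D x y z = 0"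
  shows "tris = {}"
proof -
  have "\<not> tri v u w" for v u w
    using assms[of v u w] tri_in[of v u w] by (force simp: tri_def)
  thus ?thesis by (simp add: tris_def)
qed

end

section \<open>Boundary and angles\<close>

lemma cross_inner: "cross u v \<bullet> w = det3 u v w" by (simp add: det3_def)

lemma det3_swap': "det3 v u w = - det3 u v w"
  using det3_rotate[of v u w] det3_swap[of u w v] det3_rotate[of w v u] det3_rotate[of u v w] by simp

text \<open>Pigeonhole: values with mutual distance at least \<open>d\<close> fall into different
  cells of length \<open>d\<close>. It will bound the number of contacts at a boundary vertex by the
  angle available there.\<close>

lemma separated_card_le:
  fixes f :: "'a \<Rightarrow> real"
  assumes "finite A" "d > 0" and range: "\<And>x. x \<in> A \<Longrightarrow> 0 \<le> f x \<and> f x \<le> M" "M \<ge> 0"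
    and sep: "\<And>x y. x \<in> A \<Longrightarrow> y \<in> A \<Longrightarrow> x \<noteq> y \<Longrightarrow> \<bar>f x - f y\<bar> \<ge> d"
  shows "(real (card A) - 1) * d \<le> M"
proof -
  define g where "g x = \<lfloor>f x / d\<rfloor>" for x
  have "inj_on g A"
  proof (rule inj_onI, rule ccontr)
    fix x y assume xy: "x \<in> A" "y \<in> A" "g x = g y" "x \<noteq> y"
    have "\<bar>f x / d - f y / d\<bar> < 1" using xy(3) unfolding g_def by linarith
    hence "\<bar>f x - f y\<bar> < d"
      using assms(2) by (simp add: diff_divide_distrib[symmetric] abs_divide)
    thus False using sep[OF xy(1,2,4)] by simp
  qed
  moreover have "g ` A \<subseteq> {0..\<lfloor>M / d\<rfloor>}"
    using range assms(2) by (auto simp: g_def intro!: floor_mono divide_right_mono)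
  ultimately have "card A \<le> card {0..\<lfloor>M / d\<rfloor>}"
    using card_mono[of "{0..\<lfloor>M / d\<rfloor>}" "g ` A"] card_image[of g A] by simp
  hence "card A \<le> nat (\<lfloor>M / d\<rfloor> + 1)" by simp
  moreover have "0 \<le> \<lfloor>M / d\<rfloor>" using range(2) assms(2) by simp
  ultimately have "int (card A) \<le> \<lfloor>M / d\<rfloor> + 1" by linarith
  hence "real (card A) - 1 \<le> M / d" by linarith
  thus ?thesis using assms(2) by (simp add: pos_le_divide_eq)
qed

context generic_lift
begin

section \<open>The boundary of the convex hull\<close>

lemma rightward_nonzero:
  assumes "v \<in> S" "x \<in> S" "v \<noteq> x"
  shows "rightward v \<bullet> P x \<noteq> 0"
  using rightward_pos[OF assms(1,2)] rightward_pos[OF assms(2,1)] ratio_neq[OF assms]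
    \<zeta>_pos[OF assms(1)] \<zeta>_pos[OF assms(2)]
  by (auto simp: rightward_def ratio_def inner_diff_left divide_simps mult.commute)

lemma collinear_if_on_line:
  assumes vu: "v \<in> S" "u \<in> S" "v \<noteq> u" and line: "\<And>x. x \<in> S \<Longrightarrow> D v u x = 0"
  shows "tris = {}"
proof (rule collinear_tris_empty)
  fix x y z assume xyz: "x \<in> S" "y \<in> S" "z \<in> S"
  define l where "l = cross (P v) (P u)"
  define q where "q = cross (rightward v) (P v)"
  have "P v \<bullet> P v \<noteq> 0" using \<zeta>_pos[OF vu(1)] by auto
  hence "l \<bullet> q \<noteq> 0"
    using rightward_nonzero[OF vu] rightward_self[of v] det3_cross[of "P v" "P u" "rightward v"]
    by (simp add: l_def q_def cross_inner inner_commute)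
  moreover have "l \<bullet> P x = 0" "l \<bullet> P y = 0" "l \<bullet> P z = 0"
    using line xyz by (simp_all add: l_def cross_inner)
  hence "(l \<bullet> q) * D x y z = 0" using cramer[of l q "P x" "P y" "P z"] by simp
  ultimately show "D x y z = 0" by simp
qed

lemma rim_in: "(v, u) \<in> rim \<Longrightarrow> v \<in> S \<and> u \<in> S \<and> v \<noteq> u \<and> edge v u"
  using edge_in by (auto simp: rim_def)

text \<open>Each target lies weakly to the right of the dart to the other, so both are on one line
  through \<open>v\<close>. On the same side of \<open>v\<close> they coincide as edges on one ray;
  on opposite sides the two darts confine \<open>S\<close> to that line.\<close>

lemma rim_unique:
  assumes r: "(v, u) \<in> rim" "(v, u') \<in> rim" and tris: "tris \<noteq> {}"
  shows "u = u'"
proof (rule ccontr)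
  assume ne: "u \<noteq> u'"
  have in_S: "v \<in> S" "u \<in> S" "u' \<in> S" "v \<noteq> u" "v \<noteq> u'" and e: "edge v u" "edge v u'"
    using rim_in r by blast+
  have le: "D v u x \<le> 0" "D v u' x \<le> 0" if "x \<in> S" for x using r that by (auto simp: rim_def)
  have D0: "D v u u' = 0"
    using le(1)[OF in_S(3)] le(2)[OF in_S(2)] det3_swap[of "P v" "P u" "P u'"] by simp
  define k where "k = rightward v"
  have k: "k \<bullet> P v = 0" "k \<bullet> P u \<noteq> 0" "k \<bullet> P u' \<noteq> 0"
    using rightward_self rightward_nonzero in_S by (auto simp: k_def)
  consider "k \<bullet> P u > 0" "k \<bullet> P u' > 0" | "k \<bullet> P u < 0" "k \<bullet> P u' < 0"
    | "(k \<bullet> P u) * (k \<bullet> P u') < 0"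
    using k by (auto simp: mult_less_0_iff) linarith
  thus False
  proof cases
    case 1
    hence "u \<in> fan k v" "u' \<in> fan k v" using e by (auto simp: fan_def)
    thus False using edge_same_ray[OF _ _ k(1) D0] ne by blast
  next
    case 2
    hence "u \<in> fan (- k) v" "u' \<in> fan (- k) v" using e by (auto simp: fan_def)
    moreover have "- k \<bullet> P v = 0" using k by simp
    ultimately show False using edge_same_ray[OF _ _ _ D0, of "- k"] ne by blast
  next
    case 3
    have "D v u x = 0" if x: "x \<in> S" for x
    proof (rule ccontr)
      assume "D v u x \<noteq> 0"
      hence neg: "D v u x < 0" using le(1)[OF x] by simp
      have "(k \<bullet> P u) * D v u' x = (k \<bullet> P u') * D v u x"
        using fan_plucker[OF k(1), of x u u'] D0 det3_swap[of "P v" "P x" "P u'"] by simp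
      hence "(k \<bullet> P u) * (k \<bullet> P u) * D v u' x = ((k \<bullet> P u) * (k \<bullet> P u')) * D v u x"
        by (metis mult.assoc)
      moreover have "\<dots> > 0" using 3 neg by (rule mult_neg_neg)
      moreover have "(k \<bullet> P u) * (k \<bullet> P u) * D v u' x \<le> 0"
        using le(2)[OF x] by (simp add: mult_nonneg_nonpos)
      ultimately show False by linarith
    qed
    thus False using collinear_if_on_line in_S tris by blast
  qed
qed

lemma rim_asym:
  assumes "(v, u) \<in> rim" "(u, v) \<in> rim"
  shows "tris = {}"
proof (rule collinear_if_on_line)
  show "v \<in> S" "u \<in> S" "v \<noteq> u" using rim_in assms by blast+
  show "D v u x = 0" if "x \<in> S" for x
    using assms that det3_swap'[of "P v" "P u" "P x"] by (force simp: rim_def)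
qed

section \<open>Rotation around a vertex\<close>

definition nbrs :: "'p \<Rightarrow> 'p set" where "nbrs v = {u. edge v u}"
text \<open>The next neighbour of \<open>v\<close> counterclockwise after \<open>u\<close>; a
  genuine value for darts off the rim.\<close>

definition succ_nbr :: "'p \<Rightarrow> 'p \<Rightarrow> 'p" where "succ_nbr v u = (THE w. tri v u w)"

lemma finite_nbrs: "finite (nbrs v)"
  by (rule finite_subset[OF _ finite_S]) (use edge_in in \<open>auto simp: nbrs_def\<close>)

lemma succ_nbr_eq: "tri v u w \<Longrightarrow> succ_nbr v u = w"
  unfolding succ_nbr_def using left_triangle_unique by blast

lemma tri_succ_nbr:
  assumes "u \<in> nbrs v" "(v, u) \<notin> rim"
  shows "tri v u (succ_nbr v u)"
proof -
  have e: "edge v u" using assms by (simp add: nbrs_def)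
  then obtain x where "x \<in> S" "D v u x > 0" using assms by (auto simp: rim_def not_le)
  then obtain w where "tri v u w" using left_triangle_exists[OF e] by blast
  thus ?thesis using succ_nbr_eq by metis
qed

lemma inj_succ_nbr:
  assumes "A \<subseteq> nbrs v" "\<And>u. u \<in> A \<Longrightarrow> (v, u) \<notin> rim"
  shows "inj_on (succ_nbr v) A" "succ_nbr v ` A \<subseteq> nbrs v"
proof -
  have t: "tri v u (succ_nbr v u)" if "u \<in> A" for u using tri_succ_nbr assms that by blast
  show "inj_on (succ_nbr v) A"
  proof (rule inj_onI)
    fix a b assume "a \<in> A" "b \<in> A" "succ_nbr v a = succ_nbr v b"
    hence "tri v a (succ_nbr v a)" "tri v b (succ_nbr v a)" using t by metis+
    thus "a = b" using left_triangle_unique tri_rotate by blast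
  qed
  show "succ_nbr v ` A \<subseteq> nbrs v" using t tri_edges by (force simp: nbrs_def)
qed

lemma succ_nbr_bij:
  assumes "v \<notin> fst ` rim"
  shows "bij_betw (succ_nbr v) (nbrs v) (nbrs v)"
proof -
  have "(v, u) \<notin> rim" for u using assms by force
  hence "inj_on (succ_nbr v) (nbrs v)" "succ_nbr v ` nbrs v \<subseteq> nbrs v"
    using inj_succ_nbr[of "nbrs v" v] by auto
  thus ?thesis using endo_inj_surj[OF finite_nbrs] by (auto simp: bij_betw_def)
qed

text \<open>If \<open>u\<close> started no rim dart, the successor map at \<open>u\<close> would be
  onto, so \<open>v\<close> would be a successor there; that puts a face on the left of the rim dart
  from \<open>v\<close> to \<open>u\<close>.\<close>

lemma rim_target:
  assumes "(v, u) \<in> rim"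
  shows "u \<in> fst ` rim"
proof (rule ccontr)
  assume u: "u \<notin> fst ` rim"
  have "v \<in> nbrs u" using rim_in[OF assms] edge_sym by (auto simp: nbrs_def)
  then obtain y where y: "y \<in> nbrs u" "succ_nbr u y = v"
    using succ_nbr_bij[OF u] unfolding bij_betw_def by (metis imageE)
  have "(u, y) \<notin> rim" using u by force
  hence "tri u y v" using tri_succ_nbr[OF y(1)] y(2) by simp
  hence "tri v u y" using tri_rotate by blast
  hence "D v u y > 0" "y \<in> S" using tri_in by (auto simp: tri_def)
  thus False using assms by (force simp: rim_def)
qed

lemma nbrs_nonempty:
  assumes v: "v \<in> S" and x: "x \<in> S" "x \<noteq> v"
  shows "nbrs v \<noteq> {}"
proof -
  have "rightward v \<bullet> P x > 0 \<or> - rightward v \<bullet> P x > 0"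
    using rightward_nonzero[OF v x(1)] x(2) by (auto simp: inner_minus_left)
  moreover have "- rightward v \<bullet> P v = 0" using rightward_self[of v] by (simp add: inner_minus_left)
  ultimately show ?thesis
    using edge_towards[OF v rightward_self x(1)] edge_towards[OF v _ x(1), of "- rightward v"]
    by (auto simp: nbrs_def)
qed

lemma card_rim_sources:
  assumes "tris \<noteq> {}"
  shows "card (fst ` rim) = card rim"
  by (rule card_image) (use rim_unique[OF _ _ assms] in \<open>auto simp: inj_on_def\<close>)

end

text \<open>An abstraction of the tangent direction at \<open>v\<close> towards \<open>u\<close>,
  later \<open>to_origin v u\<close>. The positive factor ties counterclockwise turning of
  directions to the orientation of the lifted faces.\<close>

locale directed_lift = generic_lift +
  fixes dir :: "'a \<Rightarrow> 'a \<Rightarrow> complex"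
  assumes dir_nonzero: "\<lbrakk>v \<in> S; u \<in> S; u \<noteq> v\<rbrakk> \<Longrightarrow> dir v u \<noteq> 0"
    and dir_orient: "\<lbrakk>v \<in> S; u \<in> S; w \<in> S; u \<noteq> v; w \<noteq> v\<rbrakk> \<Longrightarrow>
      \<exists>\<kappa>>0. det3 (P v) (P u) (P w) = \<kappa> * Im (dir v w / dir v u)"
begin

text \<open>An oriented argument rather than \<open>hyp_angle\<close>, since arguments of quotients
  add up modulo \<open>2 * pi\<close> around a vertex.\<close>

definition ang :: "'a \<Rightarrow> 'a \<Rightarrow> 'a \<Rightarrow> real" where
  "ang v u w = Arg2pi (dir v w / dir v u)"

lemma ang_pos:
  assumes "tri v u w" shows "0 < ang v u w" "ang v u w < pi"
proof -
  have "v \<in> S" "u \<in> S" "w \<in> S" "u \<noteq> v" "w \<noteq> v" and D: "D v u w > 0"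
    using tri_in[OF assms] assms by (auto simp: tri_def)
  then obtain \<kappa> where "\<kappa> > 0" "D v u w = \<kappa> * Im (dir v w / dir v u)" using dir_orient by metis
  hence "Im (dir v w / dir v u) > 0" using D by (simp add: zero_less_mult_iff)
  thus "0 < ang v u w" "ang v u w < pi" using Arg2pi_lt_pi by (auto simp: ang_def)
qed

definition corners :: "'a \<Rightarrow> ('a \<times> 'a) set" where "corners v = {(u, w). tri v u w}"

lemma sum_corners:
  assumes "A \<subseteq> nbrs v" "\<And>u. u \<in> nbrs v \<Longrightarrow> u \<in> A \<longleftrightarrow> (v, u) \<notin> rim"
  shows "(\<Sum>(u, w)\<in>corners v. ang v u w) = (\<Sum>u\<in>A. ang v u (succ_nbr v u))"
proof -
  have t: "tri v u (succ_nbr v u)" if "u \<in> A" for u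
    using that assms tri_succ_nbr by blast
  have "corners v = (\<lambda>u. (u, succ_nbr v u)) ` A"
  proof (intro set_eqI iffI)
    fix p assume "p \<in> corners v"
    then obtain u w where p: "p = (u, w)" "tri v u w" by (auto simp: corners_def)
    have "\<not> D v u w \<le> 0" "w \<in> S" using p tri_in by (auto simp: tri_def)
    hence "(v, u) \<notin> rim" by (auto simp: rim_def)
    moreover have "u \<in> nbrs v" using tri_edges[OF p(2)] by (simp add: nbrs_def)
    ultimately have "u \<in> A" using assms by blast
    thus "p \<in> (\<lambda>u. (u, succ_nbr v u)) ` A" using p succ_nbr_eq by auto
  next
    fix p assume "p \<in> (\<lambda>u. (u, succ_nbr v u)) ` A"
    thus "p \<in> corners v" using t by (auto simp: corners_def)
  qed
  moreover have "inj_on (\<lambda>u. (u, succ_nbr v u)) A" by (auto simp: inj_on_def)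
  ultimately show ?thesis by (simp add: sum.reindex)
qed

text \<open>
  Going once around \<open>v\<close> the argument of the directions returns to its initial value, so the angles
  add up to \<open>2 pi\<close> times the number of wraps, and the direction of largest argument wraps.
\<close>

lemma interior_angle_sum:
  assumes v: "v \<in> S" "x \<in> S" "x \<noteq> v" and int: "v \<notin> fst ` rim"
  shows "(\<Sum>(u, w)\<in>corners v. ang v u w) \<ge> 2 * pi"
proof -
  define \<theta> where "\<theta> u = Arg2pi (dir v u)" for u
  let ?n = "succ_nbr v"
  have rim: "(v, u) \<notin> rim" for u using int by force
  have t: "tri v u (?n u)" if "u \<in> nbrs v" for u using tri_succ_nbr that rim by blast
  have ang: "ang v u (?n u) = \<theta> (?n u) - \<theta> u + (if \<theta> u \<le> \<theta> (?n u) then 0 else 2 * pi)"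
    if u: "u \<in> nbrs v" for u
  proof -
    have nz: "dir v u \<noteq> 0" "dir v (?n u) \<noteq> 0" using tri_in[OF t[OF u]] dir_nonzero by auto
    show ?thesis using Arg2pi_diff[OF nz(2,1)] by (simp add: ang_def \<theta>_def split: if_splits)
  qed
  have ne: "nbrs v \<noteq> {}" using nbrs_nonempty v by blast
  have "Max (\<theta> ` nbrs v) \<in> \<theta> ` nbrs v" using ne finite_nbrs by (intro Max_in) auto
  then obtain m where m: "m \<in> nbrs v" "\<theta> m = Max (\<theta> ` nbrs v)" by auto
  have bij: "bij_betw ?n (nbrs v) (nbrs v)" by (rule succ_nbr_bij[OF int])
  have "\<theta> (?n m) \<le> \<theta> m"
    unfolding m(2) using bij m(1) finite_nbrs by (intro Max_ge) (auto simp: bij_betw_def)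
  hence wrap: "ang v m (?n m) - (\<theta> (?n m) - \<theta> m) = 2 * pi"
    using ang[OF m(1)] ang_pos[OF t[OF m(1)]] by (auto split: if_splits)
  have "2 * pi \<le> (\<Sum>u\<in>nbrs v. ang v u (?n u) - (\<theta> (?n u) - \<theta> u))"
    unfolding wrap[symmetric]
    by (rule member_le_sum[OF m(1) _ finite_nbrs]) (simp add: ang)
  also have "\<dots> = (\<Sum>u\<in>nbrs v. ang v u (?n u))"
    using sum.reindex_bij_betw[OF bij, of \<theta>] by (simp add: sum_subtractf)
  also have "\<dots> = (\<Sum>(u, w)\<in>corners v. ang v u w)"
    by (rule sum_corners[symmetric]) (use rim in auto)
  finally show ?thesis .
qed

text \<open>All neighbours lie weakly right of the rim dart, so \<open>\<phi>\<close>, the turn from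
  a neighbour to \<open>u0\<close>, takes values in \<open>[0, pi]\<close>. Corner angles are its
  decrements and telescope to its maximum, while the members of \<open>A\<close> have values of
  \<open>\<phi>\<close> at mutual distance at least \<open>\<delta>\<close>.\<close>

lemma boundary_angle_sum:
  assumes r: "(v, u0) \<in> rim" and tris: "tris \<noteq> {}" and A: "A \<subseteq> nbrs v"
    and \<delta>: "0 < \<delta>" "\<delta> < pi"
    and sep: "\<And>u w. u \<in> A \<Longrightarrow> w \<in> A \<Longrightarrow> u \<noteq> w \<Longrightarrow>
      Re (dir v w / dir v u) \<le> cos \<delta> * cmod (dir v w / dir v u)"
  shows "(\<Sum>(u, w)\<in>corners v. ang v u w) \<ge> (real (card A) - 1) * \<delta>"
proof -
  define N where "N = nbrs v"
  define \<phi> where "\<phi> u = Arg2pi (dir v u0 / dir v u)" for u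
  let ?n = "succ_nbr v"
  have v: "v \<in> S" "u0 \<in> S" "u0 \<noteq> v" and u0: "u0 \<in> N"
    using rim_in[OF r] by (auto simp: N_def nbrs_def)
  have N: "u \<in> S \<and> u \<noteq> v" if "u \<in> N" for u using that edge_in by (auto simp: N_def nbrs_def)
  have nz: "dir v u \<noteq> 0" if "u \<in> N" for u using dir_nonzero N that v by auto
  have range: "0 \<le> \<phi> u \<and> \<phi> u \<le> pi" if u: "u \<in> N" for u
  proof -
    obtain \<kappa> where \<kappa>: "\<kappa> > 0" "D v u0 u = \<kappa> * Im (dir v u / dir v u0)"
      using dir_orient v N[OF u] by metis
    have "D v u0 u \<le> 0" using r N[OF u] by (auto simp: rim_def)
    hence "Im (dir v u / dir v u0) \<le> 0" using \<kappa> by (simp add: mult_le_0_iff)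
    hence "Im (inverse (dir v u / dir v u0)) \<ge> 0"
      unfolding inverse_complex.sel by (intro divide_nonneg_nonneg) auto
    hence "\<phi> u \<le> pi" unfolding \<phi>_def Arg2pi_le_pi by simp
    thus ?thesis using Arg2pi[of "dir v u0 / dir v u"] by (simp add: \<phi>_def)
  qed
  have not_rim: "(v, u) \<notin> rim" if "u \<in> N - {u0}" for u
    using rim_unique[OF r _ tris] that by blast
  have t: "tri v u (?n u)" if "u \<in> N - {u0}" for u
    using tri_succ_nbr not_rim that by (auto simp: N_def)
  have nN: "?n u \<in> N" if "u \<in> N - {u0}" for u
    using tri_edges[OF t[OF that]] by (auto simp: N_def nbrs_def)
  have ang: "ang v u (?n u) = \<phi> u - \<phi> (?n u)" if u: "u \<in> N - {u0}" for u
  proof -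
    have "ang v u (?n u) + \<phi> (?n u) < 2 * pi" using ang_pos[OF t[OF u]] range[OF nN[OF u]] by simp
    hence "Arg2pi (dir v (?n u) / dir v u * (dir v u0 / dir v (?n u))) = ang v u (?n u) + \<phi> (?n u)"
      unfolding ang_def \<phi>_def using nz[OF nN[OF u]] nz[OF u0] nz[of u] u
      by (subst Arg2pi_times) (auto simp: add.commute)
    moreover have "dir v (?n u) / dir v u * (dir v u0 / dir v (?n u)) = dir v u0 / dir v u"
      using nz[OF nN[OF u]] by simp
    ultimately show ?thesis by (simp add: \<phi>_def)
  qed
  have fin: "finite N" by (simp add: N_def finite_nbrs)
  have "Max (\<phi> ` N) \<in> \<phi> ` N" using u0 fin by (intro Max_in) auto
  then obtain m where m: "m \<in> N" "\<phi> m = Max (\<phi> ` N)" by auto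
  have mmax: "\<phi> u \<le> \<phi> m" if "u \<in> N" for u
    unfolding m(2) using that fin by (intro Max_ge) auto
  have inj: "inj_on ?n (N - {u0})"
    by (rule inj_succ_nbr) (use not_rim in \<open>auto simp: N_def\<close>)
  \<comment> \<open>Successors strictly decrease \<open>\<phi>\<close>, so the maximum is never a
    successor; counting then shows that every other neighbour is one.\<close>
  have "?n u \<noteq> m" if "u \<in> N - {u0}" for u
    using ang[OF that] ang_pos[OF t[OF that]] mmax[of u] that by auto
  hence "?n ` (N - {u0}) \<subseteq> N - {m}" using nN by blast
  moreover have "card (N - {m}) = card (?n ` (N - {u0}))"
    using card_image[OF inj] m(1) u0 fin by simp
  ultimately have img: "?n ` (N - {u0}) = N - {m}"
    using fin by (intro card_subset_eq) auto
  have "(\<Sum>(u, w)\<in>corners v. ang v u w) = (\<Sum>u\<in>N - {u0}. ang v u (?n u))"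
    by (rule sum_corners) (use not_rim r in \<open>auto simp: N_def\<close>)
  also have "\<dots> = (\<Sum>u\<in>N - {u0}. \<phi> u) - (\<Sum>u\<in>N - {u0}. \<phi> (?n u))"
    unfolding sum_subtractf[symmetric] by (rule sum.cong[OF refl ang])
  also have "(\<Sum>u\<in>N - {u0}. \<phi> (?n u)) = (\<Sum>u\<in>N - {m}. \<phi> u)"
    using sum.reindex[OF inj, of \<phi>] by (simp add: img)
  also have "(\<Sum>u\<in>N - {u0}. \<phi> u) - (\<Sum>u\<in>N - {m}. \<phi> u) = \<phi> m - \<phi> u0"
    using fin m(1) u0 by (simp add: sum_diff1)
  also have "\<phi> u0 = 0" using nz[OF u0] Arg2pi_of_real[of 1] by (simp add: \<phi>_def)
  finally have sum: "(\<Sum>(u, w)\<in>corners v. ang v u w) = \<phi> m" by simp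
  have "(real (card A) - 1) * \<delta> \<le> \<phi> m"
  proof (rule separated_card_le[where f = \<phi>])
    show "finite A" using A fin by (auto simp: N_def intro: finite_subset)
    show "0 \<le> \<phi> x \<and> \<phi> x \<le> \<phi> m" if "x \<in> A" for x
      using that A range mmax by (auto simp: N_def)
    show "0 \<le> \<phi> m" using range m(1) by blast
    fix u w assume uw: "u \<in> A" "w \<in> A" "u \<noteq> w"
    hence uwN: "u \<in> N" "w \<in> N" using A by (auto simp: N_def)
    define z1 z2 where "z1 = dir v u0 / dir v u" and "z2 = dir v u0 / dir v w"
    have z: "z1 \<noteq> 0" "z2 \<noteq> 0" using nz uwN u0 by (auto simp: z1_def z2_def)
    have q: "dir v w / dir v u = z1 / z2" using nz uwN u0 by (simp add: z1_def z2_def)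
    have "z1 = of_real (cmod z1) * exp (\<i> * of_real (\<phi> u))" "z2 = of_real (cmod z2) * exp (\<i> * of_real (\<phi> w))"
      using Arg2pi_eq[of z1] Arg2pi_eq[of z2] by (simp_all add: z1_def z2_def \<phi>_def)
    hence "z1 / z2 = of_real (cmod z1 / cmod z2) * exp (\<i> * of_real (\<phi> u - \<phi> w))"
      using z by (metis (no_types, lifting) exp_diff of_real_diff of_real_divide right_diff_distrib times_divide_times_eq)
    hence "Re (z1 / z2) = Re (of_real (cmod z1 / cmod z2) * cis (\<phi> u - \<phi> w))"
      by (simp only: cis_conv_exp)
    hence "Re (z1 / z2) = cmod (z1 / z2) * cos (\<phi> u - \<phi> w)"
      by (simp only: Re_complex_of_real Im_complex_of_real times_complex.sel cis.sel norm_divide mult_zero_left diff_zero)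
    hence "cmod (z1 / z2) * cos (\<phi> u - \<phi> w) \<le> cmod (z1 / z2) * cos \<delta>"
      using sep[OF uw] by (simp add: q mult.commute)
    hence cos: "cos \<bar>\<phi> u - \<phi> w\<bar> \<le> cos \<delta>" using z by simp
    show "\<delta> \<le> \<bar>\<phi> u - \<phi> w\<bar>"
    proof (rule ccontr)
      assume "\<not> \<delta> \<le> \<bar>\<phi> u - \<phi> w\<bar>"
      hence "cos \<delta> < cos \<bar>\<phi> u - \<phi> w\<bar>" using \<delta> by (intro cos_monotone_0_pi) auto
      thus False using cos by simp
    qed
  qed (fact \<delta>)
  thus ?thesis by (simp add: sum)
qed

end

section \<open>Counting contacts at the boundary\<close>

text \<open>\<open>G\<close> will be the contacts as darts; these assumptions are all that the
  counting takes from the hyperbolic metric.\<close>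

locale seven_lift = directed_lift +
  fixes G :: "('a \<times> 'a) set"
  assumes G_darts: "G \<subseteq> darts"
    and G_sym: "(v, u) \<in> G \<Longrightarrow> (u, v) \<in> G"
    and G_sep: "\<lbrakk>(v, u) \<in> G; (v, w) \<in> G; u \<noteq> w\<rbrakk> \<Longrightarrow>
      Re (dir v w / dir v u) \<le> cos (2 * pi / 7) * cmod (dir v w / dir v u)"
    and angle_sum: "tri v u w \<Longrightarrow> ang v u w + ang u w v + ang w v u \<le> pi"
    and unit_angle: "\<lbrakk>tri v u w; (v, u) \<in> G; (u, w) \<in> G; (w, v) \<in> G\<rbrakk> \<Longrightarrow> ang v u w = 2 * pi / 7"
begin

definition sources :: "'a set" where "sources = fst ` rim"

lemma finite_G: "finite G"
  using G_darts finite_darts by (rule finite_subset)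

lemma sources_subset: "sources \<subseteq> S"
  using rim_in by (auto simp: sources_def)

lemma finite_rim: "finite rim"
  using rim_subset finite_darts by (rule finite_subset)

lemma finite_sources: "finite sources"
  by (simp add: sources_def finite_rim)

lemma sum_tris_corners:
  "(\<Sum>(v, u, w)\<in>tris. f v u w) = (\<Sum>v\<in>S. \<Sum>(u, w)\<in>corners v. (f v u w :: real))"
proof -
  have "corners v \<subseteq> S \<times> S" for v using tri_in by (auto simp: corners_def)
  hence fin: "finite (corners v)" for v using finite_S by (meson finite_SigmaI finite_subset)
  have "tris = Sigma S corners"
    using tri_in by (auto simp: tris_def corners_def)
  thus ?thesis using sum.Sigma[OF finite_S, of corners "\<lambda>v p. f v (fst p) (snd p)"] fin
    by (simp add: case_prod_unfold)
qed

lemma sum_tris_rotate: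
  "(\<Sum>(v, u, w)\<in>tris. f u w v) = (\<Sum>(v, u, w)\<in>tris. (f v u w :: real))"
  by (rule sum.reindex_bij_witness[where i = "\<lambda>(v, u, w). (w, v, u)" and j = "\<lambda>(v, u, w). (u, w, v)"])
     (auto simp: tris_def dest: tri_rotate)

text \<open>A face with a non-contact side may exceed the equilateral sum \<open>6 * pi / 7\<close>
  by \<open>pi / 7\<close>, and this excess is charged to every non-contact dart of the face.
  Non-contact darts of the rim have no face on their left and are not charged.\<close>

lemma angle_total_upper:
  "(\<Sum>(v, u, w)\<in>tris. ang v u w)
    \<le> 2 * pi / 7 * real (card tris) + pi / 7 * (real (card (darts - G)) - real (card (rim - G)))"
proof -
  define X where "X = {(v, u, w). tri v u w \<and> (v, u) \<notin> G}"
  define g :: "'a \<Rightarrow> 'a \<Rightarrow> real" where "g v u = (if (v, u) \<in> G then 0 else pi / 7)" for v u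
  have "ang v u w + ang u w v + ang w v u \<le> 6 * pi / 7 + (g v u + g u w + g w v)"
    if t: "tri v u w" for v u w
  proof (cases "(v, u) \<in> G \<and> (u, w) \<in> G \<and> (w, v) \<in> G")
    case True
    hence "ang v u w = 2 * pi / 7" "ang u w v = 2 * pi / 7" "ang w v u = 2 * pi / 7"
      using unit_angle t tri_rotate by blast+
    thus ?thesis using True by (simp add: g_def)
  next
    case False
    hence "pi / 7 \<le> g v u + g u w + g w v" by (auto simp: g_def)
    thus ?thesis using angle_sum[OF t] by linarith
  qed
  hence "(\<Sum>(v, u, w)\<in>tris. ang v u w + ang u w v + ang w v u)
    \<le> (\<Sum>(v, u, w)\<in>tris. 6 * pi / 7 + (g v u + g u w + g w v))"
    by (intro sum_mono) (auto simp: tris_def)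
  also have "(\<Sum>(v, u, w)\<in>tris. ang v u w + ang u w v + ang w v u) = 3 * (\<Sum>(v, u, w)\<in>tris. ang v u w)"
  proof -
    have "(\<Sum>(v, u, w)\<in>tris. ang v u w + ang u w v + ang w v u) = (\<Sum>(v, u, w)\<in>tris. ang v u w)
      + (\<Sum>(v, u, w)\<in>tris. ang u w v) + (\<Sum>(v, u, w)\<in>tris. ang w v u)"
      by (simp add: sum.distrib case_prod_unfold)
    also have "(\<Sum>(v, u, w)\<in>tris. ang w v u) = (\<Sum>(v, u, w)\<in>tris. ang u w v)"
      by (rule sum_tris_rotate[of "\<lambda>v u w. ang u w v"])
    finally show ?thesis using sum_tris_rotate[of ang] by simp
  qed
  also have "(\<Sum>(v, u, w)\<in>tris. 6 * pi / 7 + (g v u + g u w + g w v))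
    = 6 * pi / 7 * real (card tris) + 3 * (\<Sum>(v, u, w)\<in>tris. g v u)"
  proof -
    have "(\<Sum>(v, u, w)\<in>tris. 6 * pi / 7 + (g v u + g u w + g w v)) = 6 * pi / 7 * real (card tris)
      + ((\<Sum>(v, u, w)\<in>tris. g v u) + (\<Sum>(v, u, w)\<in>tris. g u w) + (\<Sum>(v, u, w)\<in>tris. g w v))"
      by (simp add: sum.distrib case_prod_unfold mult.commute)
    also have "(\<Sum>(v, u, w)\<in>tris. g w v) = (\<Sum>(v, u, w)\<in>tris. g u w)"
      by (rule sum_tris_rotate[of "\<lambda>v u w. g u w"])
    finally show ?thesis using sum_tris_rotate[of "\<lambda>v u w. g v u"] by simp
  qed
  also have "(\<Sum>(v, u, w)\<in>tris. g v u) = (\<Sum>(v, u, w)\<in>X. pi / 7)"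
    by (rule sum.mono_neutral_cong_right) (auto simp: X_def tris_def g_def finite_tris[unfolded tris_def])
  also have "\<dots> = pi / 7 * real (card X)" by (simp add: case_prod_unfold mult.commute)
  finally have main: "(\<Sum>(v, u, w)\<in>tris. ang v u w) \<le> 2 * pi / 7 * real (card tris) + pi / 7 * real (card X)"
    by linarith
  have "card X \<le> card ((darts - G) - (rim - G))"
  proof (rule card_inj_on_le[where f = "\<lambda>(v, u, w). (v, u)"])
    show "inj_on (\<lambda>(v, u, w). (v, u)) X"
    proof (rule inj_onI)
      fix a b assume "a \<in> X" "b \<in> X" "(\<lambda>(v, u, w). (v, u)) a = (\<lambda>(v, u, w). (v, u)) b"
      moreover obtain v u w where "a = (v, u, w)" by (cases a)
      moreover obtain v' u' w' where "b = (v', u', w')" by (cases b)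
      ultimately show "a = b" using left_triangle_unique[of v u w w'] by (simp add: X_def)
    qed
    show "(\<lambda>(v, u, w). (v, u)) ` X \<subseteq> (darts - G) - (rim - G)"
    proof
      fix p assume "p \<in> (\<lambda>(v, u, w). (v, u)) ` X"
      then obtain v u w where p: "p = (v, u)" "tri v u w" "(v, u) \<notin> G" by (auto simp: X_def)
      have "\<not> D v u w \<le> 0" "w \<in> S" using p tri_in by (auto simp: tri_def)
      hence "(v, u) \<notin> rim" by (auto simp: rim_def)
      thus "p \<in> (darts - G) - (rim - G)" using p tri_edges[OF p(2)] by (simp add: darts_def)
    qed
    show "finite ((darts - G) - (rim - G))" using finite_darts by simp
  qed
  also have "card ((darts - G) - (rim - G)) = card (darts - G) - card (rim - G)"
    by (rule card_Diff_subset) (use finite_rim rim_subset in auto)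
  finally have "card X \<le> card (darts - G) - card (rim - G)" .
  moreover have "card (rim - G) \<le> card (darts - G)"
    by (rule card_mono) (use finite_darts rim_subset in auto)
  ultimately have "real (card X) \<le> real (card (darts - G)) - real (card (rim - G))" by linarith
  hence "pi / 7 * real (card X) \<le> pi / 7 * (real (card (darts - G)) - real (card (rim - G)))"
    by (intro mult_left_mono) auto
  thus ?thesis using main by linarith
qed

text \<open>A full turn equals seven unit angles, and \<open>k\<close> contacts at a boundary vertex
  span at least \<open>k - 1\<close> of them. Inequalities suffice, so winding more than once around
  a vertex is harmless.\<close>

lemma angle_total_lower:
  assumes tris: "tris \<noteq> {}"
  shows "(\<Sum>(v, u, w)\<in>tris. ang v u w)
    \<ge> 2 * pi / 7 * (7 * (real (card S) - real (card sources))
        + real (card {(v, u) \<in> G. v \<in> sources}) - real (card sources))"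
proof -
  define A where "A v = {u. (v, u) \<in> G}" for v
  have A: "A v \<subseteq> nbrs v" for v using G_darts by (auto simp: A_def nbrs_def darts_def)
  hence finA: "finite (A v)" for v using finite_nbrs finite_subset by blast
  obtain x y z where "tri x y z" using tris by (auto simp: tris_def)
  hence xy: "x \<in> S" "y \<in> S" "x \<noteq> y" using tri_in by auto
  have int: "(\<Sum>(u, w)\<in>corners v. ang v u w) \<ge> 2 * pi" if v: "v \<in> S - sources" for v
  proof -
    obtain x' where "x' \<in> S" "x' \<noteq> v" using xy by metis
    thus ?thesis using interior_angle_sum[of v x'] v by (auto simp: sources_def)
  qed
  have bd: "(\<Sum>(u, w)\<in>corners v. ang v u w) \<ge> (real (card (A v)) - 1) * (2 * pi / 7)"
    if v: "v \<in> sources" for v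
  proof -
    obtain u0 where r: "(v, u0) \<in> rim" using v by (auto simp: sources_def)
    show ?thesis
      by (rule boundary_angle_sum[OF r tris A]) (use G_sep in \<open>auto simp: A_def\<close>)
  qed
  have G_eq: "{(v, u) \<in> G. v \<in> sources} = Sigma sources A" by (auto simp: A_def)
  have cG: "card {(v, u) \<in> G. v \<in> sources} = (\<Sum>v\<in>sources. card (A v))"
    unfolding G_eq using finA by (simp add: finite_sources)
  have "2 * pi / 7 * (7 * (real (card S) - real (card sources))
        + real (card {(v, u) \<in> G. v \<in> sources}) - real (card sources))
      = (\<Sum>v\<in>S - sources. 2 * pi) + (\<Sum>v\<in>sources. (real (card (A v)) - 1) * (2 * pi / 7))"
  proof -
    have "card (S - sources) = card S - card sources" "card sources \<le> card S"
      using sources_subset finite_sources finite_S by (auto simp: card_Diff_subset intro: card_mono)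
    moreover have "(\<Sum>v\<in>sources. (real (card (A v)) - 1) * (2 * pi / 7))
      = (real (card {(v, u) \<in> G. v \<in> sources}) - real (card sources)) * (2 * pi / 7)"
      unfolding sum_distrib_right[symmetric] cG by (simp add: sum_subtractf)
    ultimately show ?thesis by (simp add: of_nat_diff algebra_simps)
  qed
  also have "\<dots> \<le> (\<Sum>v\<in>S - sources. \<Sum>(u, w)\<in>corners v. ang v u w)
      + (\<Sum>v\<in>sources. \<Sum>(u, w)\<in>corners v. ang v u w)"
    by (intro add_mono sum_mono int bd)
  also have "\<dots> = (\<Sum>v\<in>S. \<Sum>(u, w)\<in>corners v. ang v u w)"
    using sum.subset_diff[OF sources_subset finite_S, of "\<lambda>v. \<Sum>(u, w)\<in>corners v. ang v u w"] by simp
  finally show ?thesis by (simp only: sum_tris_corners)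
qed

lemma card_tris_darts:
  assumes "tris \<noteq> {}"
  shows "real (card darts) = 6 * real (card S) - 6 - 2 * real (card sources)"
    and "real (card tris) = 6 * real (card S) - 6 - 3 * real (card sources)"
proof -
  have "S \<noteq> {}" using assms tri_in by (auto simp: tris_def)
  hence "3 * card darts + 6 = 2 * card tris + 6 * card S" by (rule euler_darts_tris)
  moreover have "card darts = card tris + card sources"
    using card_darts_rim card_rim_sources[OF assms] by (simp add: sources_def)
  ultimately show "real (card darts) = 6 * real (card S) - 6 - 2 * real (card sources)"
    "real (card tris) = 6 * real (card S) - 6 - 3 * real (card sources)" by linarith+
qed

text \<open>Unless all points are collinear, no edge has both darts on the rim, so \<open>R\<close>
  and its reversal are disjoint.\<close>

lemma card_rim_symmetric:
  assumes tris: "tris \<noteq> {}" and R: "R \<subseteq> rim" and Q: "finite Q" "R \<subseteq> Q" "prod.swap ` R \<subseteq> Q"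
  shows "2 * card R \<le> card Q"
proof -
  have "\<not> ((a, b) \<in> R \<and> (b, a) \<in> R)" for a b
    using rim_asym[of a b] tris R by blast
  hence "R \<inter> prod.swap ` R = {}" by auto
  moreover have "finite R" using Q finite_subset by blast
  moreover have "card (prod.swap ` R) = card R" by (rule card_image) simp
  ultimately have "card (R \<union> prod.swap ` R) = 2 * card R" by (simp add: card_Un_disjoint)
  moreover have "card (R \<union> prod.swap ` R) \<le> card Q" by (rule card_mono) (use Q in auto)
  ultimately show ?thesis by simp
qed

text \<open>Contacts with both ends on the boundary are counted from both ends, so they are
  subtracted once; they include the contact edges of the hull. With \<open>r\<close> hull edges that
  are not contacts the error is \<open>m + r\<close>, and \<open>r \<le> m / 2\<close> gives the
  factor \<open>3 / 2\<close>.\<close>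

lemma touching_sources:
  assumes tris: "tris \<noteq> {}"
  shows "real (card {(v, u) \<in> G. v \<in> sources \<or> u \<in> sources})
    \<le> 8 * real (card sources) - 2 * real (card S) - 12 + 3 / 2 * real (card (darts - G))"
proof -
  define h n m r \<sigma> where "h = real (card sources)" and "n = real (card S)"
    and "m = real (card (darts - G))" and "r = real (card (rim - G))"
    and "\<sigma> = real (card {(v, u) \<in> G. v \<in> sources})"
  let ?I = "{(v, u) \<in> G. v \<in> sources}" and ?J = "{(v, u) \<in> G. u \<in> sources}"
    and ?K = "{(v, u) \<in> G. v \<in> sources \<and> u \<in> sources}"
  have "2 * pi / 7 * (7 * (n - h) + \<sigma> - h) \<le> 2 * pi / 7 * real (card tris) + pi / 7 * (m - r)"
    using angle_total_lower[OF tris] angle_total_upper unfolding h_def n_def m_def r_def \<sigma>_def by linarith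
  also have "\<dots> = 2 * pi / 7 * (real (card tris) + (m - r) / 2)" by (simp add: field_simps)
  finally have "7 * (n - h) + \<sigma> - h \<le> real (card tris) + (m - r) / 2" by simp
  hence \<sigma>: "\<sigma> \<le> 5 * h - n - 6 + (m - r) / 2"
    using card_tris_darts(2)[OF tris] by (simp add: n_def h_def)
  have fin: "finite ?I" "finite ?J" "finite ?K" by (rule finite_subset[OF _ finite_G]; auto)+
  have "?J = prod.swap ` ?I" using G_sym by (force simp: image_iff)
  hence IJ: "card ?J = card ?I" using card_image[of prod.swap ?I] by simp
  have "{(v, u) \<in> G. v \<in> sources \<or> u \<in> sources} = ?I \<union> ?J" "?I \<inter> ?J = ?K" by auto
  hence un: "card {(v, u) \<in> G. v \<in> sources \<or> u \<in> sources} + card ?K = 2 * card ?I"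
    using card_Un_Int[OF fin(1,2)] IJ by simp
  have "2 * card (rim \<inter> G) \<le> card ?K"
  proof (rule card_rim_symmetric[OF tris])
    show "rim \<inter> G \<subseteq> ?K" using rim_target by (force simp: sources_def)
    show "prod.swap ` (rim \<inter> G) \<subseteq> ?K" using rim_target G_sym by (force simp: sources_def)
  qed (use fin in auto)
  moreover have "card (rim \<inter> G) + card (rim - G) = card rim"
    using card_Int_Diff[OF finite_rim, of G] by simp
  moreover have "real (card rim) = h" using card_rim_sources[OF tris] by (simp add: h_def sources_def)
  ultimately have K: "2 * (h - r) \<le> real (card ?K)" by (simp add: r_def)
  have "2 * card (rim - G) \<le> card (darts - G)"
  proof (rule card_rim_symmetric[OF tris])
    show "rim - G \<subseteq> darts - G" using rim_subset by blast
    show "prod.swap ` (rim - G) \<subseteq> darts - G"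
      using rim_subset G_sym edge_sym by (auto simp: darts_def)
  qed (use finite_darts in auto)
  hence "2 * r \<le> m" by (simp add: r_def m_def)
  moreover have "real (card {(v, u) \<in> G. v \<in> sources \<or> u \<in> sources}) + real (card ?K) = 2 * real (card ?I)"
    using arg_cong[OF un, of real] by simp
  ultimately have "real (card {(v, u) \<in> G. v \<in> sources \<or> u \<in> sources}) \<le> 8 * h - 2 * n - 12 + 3 / 2 * m"
    using \<sigma> K unfolding \<sigma>_def by argo
  thus ?thesis by (simp only: h_def n_def m_def)
qed

lemma card_G:
  assumes "tris \<noteq> {}"
  shows "real (card G) = 6 * real (card S) - 6 - 2 * real (card sources) - real (card (darts - G))"
  using card_tris_darts(1)[OF assms] card_Diff_subset[OF finite_G G_darts] card_mono[OF finite_darts G_darts]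
  by (simp add: of_nat_diff)

lemma card_G_collinear:
  assumes "tris = {}" "S \<noteq> {}"
  shows "real (card G) \<le> 2 * real (card S) - 2"
  using euler_darts_tris[OF assms(2)] assms(1) card_mono[OF finite_darts G_darts] by simp

end

section \<open>Generic weights\<close>

text \<open>
  For \<open>c x = t ^ i x\<close> with distinct exponents every linear dependency that the weights have to
  avoid is a nonzero polynomial in \<open>t\<close>.
\<close>

lemma generic_weights:
  fixes P :: "'p \<Rightarrow> vec3"
  assumes S: "finite S" and cross_nz: "\<And>u v. u \<in> S \<Longrightarrow> v \<in> S \<Longrightarrow> u \<noteq> v \<Longrightarrow> cross (P u) (P v) \<noteq> 0"
    and e: "e > 0"
  shows "\<exists>c. (\<forall>x\<in>S. 1 \<le> c x \<and> c x < 1 + e) \<and>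
    (\<forall>l u v w. {u, v, w} \<subseteq> S \<longrightarrow> distinct [u, v, w] \<longrightarrow> l \<bullet> P u = c u \<longrightarrow> l \<bullet> P v = c v \<longrightarrow>
      l \<bullet> P w = c w \<longrightarrow> det3 (P u) (P v) (P w) \<noteq> 0) \<and>
    (\<forall>l u v w x. {u, v, w, x} \<subseteq> S \<longrightarrow> distinct [u, v, w, x] \<longrightarrow> l \<bullet> P u = c u \<longrightarrow>
      l \<bullet> P v = c v \<longrightarrow> l \<bullet> P w = c w \<longrightarrow> l \<bullet> P x \<noteq> c x)"
proof -
  obtain i :: "'p \<Rightarrow> nat" and N where i: "inj_on i S"
    using finite_imp_inj_to_nat_seg[OF S] by blast
  \<comment> \<open>If \<open>P u\<close>, \<open>P v\<close>, \<open>P w\<close> were dependent,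
    Cramer with the fourth vector \<open>cross (P u) (P v)\<close> would make \<open>t\<close> a
    root; the coefficient at \<open>i w\<close> is the squared length of that cross product.\<close>
  define q3 where "q3 = (\<lambda>(u, v, w). monom (det3 (P u) (P v) (cross (P u) (P v))) (i w)
    - monom (det3 (P w) (P v) (cross (P u) (P v))) (i u)
    - monom (det3 (P u) (P w) (cross (P u) (P v))) (i v))"
  \<comment> \<open>The relation for four tight points; its coefficient at \<open>i x\<close> is
    nonzero by the case of three.\<close>
  define q4 where "q4 = (\<lambda>(u, v, w, x). monom (det3 (P u) (P v) (P w)) (i x)
    - monom (det3 (P x) (P v) (P w)) (i u) - monom (det3 (P u) (P x) (P w)) (i v)
    - monom (det3 (P u) (P v) (P x)) (i w))"
  define Q where "Q = (q3 ` (S \<times> S \<times> S) \<union> q4 ` (S \<times> S \<times> S \<times> S)) - {0}"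
  define bad where "bad = (\<Union>q\<in>Q. {t::real. poly q t = 0})"
  have "finite Q" using S by (simp add: Q_def)
  hence bad: "finite bad" unfolding bad_def by (intro finite_UN_I poly_roots_finite) (auto simp: Q_def)
  have "\<forall>\<^sub>F t in at_right (1::real). \<forall>x\<in>S. t ^ i x < 1 + e"
    unfolding eventually_ball_finite_distrib[OF S]
  proof
    fix x
    have "((\<lambda>t::real. t ^ i x) \<longlongrightarrow> 1 ^ i x) (at_right 1)" by (intro tendsto_intros)
    thus "\<forall>\<^sub>F t in at_right (1::real). t ^ i x < 1 + e"
      by (rule order_tendstoD(2)) (use e in simp)
  qed
  then obtain b where b: "b > 1" "\<And>t x. 1 < t \<Longrightarrow> t < b \<Longrightarrow> x \<in> S \<Longrightarrow> t ^ i x < 1 + e"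
    unfolding eventually_at_right_field by blast
  have "infinite ({1<..<b} - bad)" using b(1) bad by (simp add: Diff_infinite_finite infinite_Ioo)
  hence "{1<..<b} - bad \<noteq> {}" by (metis finite.emptyI)
  then obtain t where "t \<in> {1<..<b} - bad" by blast
  hence t: "1 < t" "t < b" "t \<notin> bad" by simp_all
  define c where "c x = t ^ i x" for x
  have q: "poly q t \<noteq> 0" if "q \<in> q3 ` (S \<times> S \<times> S) \<union> q4 ` (S \<times> S \<times> S \<times> S)" "coeff q n \<noteq> 0" for q n
  proof -
    have "q \<in> Q" using that by (auto simp: Q_def)
    thus ?thesis using t(3) by (auto simp: bad_def)
  qed
  have one: "1 \<le> c x \<and> c x < 1 + e" if "x \<in> S" for x
    using b(2)[of t x] t that by (simp add: c_def)
  have three: "det3 (P u) (P v) (P w) \<noteq> 0"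
    if S: "{u, v, w} \<subseteq> S" and d: "distinct [u, v, w]"
      and l: "l \<bullet> P u = c u" "l \<bullet> P v = c v" "l \<bullet> P w = c w" for u v w l
  proof
    assume D: "det3 (P u) (P v) (P w) = 0"
    have ij: "i w \<noteq> i u" "i w \<noteq> i v" using i S d by (auto simp: inj_on_def)
    have "cross (P u) (P v) \<noteq> 0" using cross_nz S d by simp
    hence "coeff (q3 (u, v, w)) (i w) \<noteq> 0"
      using ij by (simp add: q3_def det3_def)
    hence "poly (q3 (u, v, w)) t \<noteq> 0" using S by (intro q) auto
    moreover have "poly (q3 (u, v, w)) t = (l \<bullet> P w) * det3 (P u) (P v) (cross (P u) (P v))
      - (l \<bullet> P u) * det3 (P w) (P v) (cross (P u) (P v)) - (l \<bullet> P v) * det3 (P u) (P w) (cross (P u) (P v))"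
      by (simp add: q3_def poly_monom l c_def)
    ultimately show False
      using cramer[of l "P w" "P u" "P v" "cross (P u) (P v)"] D by simp
  qed
  have four: "l \<bullet> P x \<noteq> c x"
    if S: "{u, v, w, x} \<subseteq> S" and d: "distinct [u, v, w, x]"
      and l: "l \<bullet> P u = c u" "l \<bullet> P v = c v" "l \<bullet> P w = c w" for u v w x l
  proof
    assume lx: "l \<bullet> P x = c x"
    have ij: "i x \<noteq> i u" "i x \<noteq> i v" "i x \<noteq> i w" using i S d by (auto simp: inj_on_def)
    have "det3 (P u) (P v) (P w) \<noteq> 0" using three[of u v w l] S d l by simp
    hence "coeff (q4 (u, v, w, x)) (i x) \<noteq> 0" using ij by (simp add: q4_def)
    hence "poly (q4 (u, v, w, x)) t \<noteq> 0" using S by (intro q) auto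
    moreover have "poly (q4 (u, v, w, x)) t = (l \<bullet> P x) * det3 (P u) (P v) (P w)
      - (l \<bullet> P u) * det3 (P x) (P v) (P w) - (l \<bullet> P v) * det3 (P u) (P x) (P w)
      - (l \<bullet> P w) * det3 (P u) (P v) (P x)"
      by (simp add: q4_def poly_monom l lx c_def)
    ultimately show False using cramer[of l "P x" "P u" "P v" "P w"] by simp
  qed
  show ?thesis
  proof (intro exI[of _ c] conjI allI impI)
    show "\<forall>x\<in>S. 1 \<le> c x \<and> c x < 1 + e" using one by simp
  qed (rule three, assumption+, rule four, assumption+)
qed

section \<open>The hyperboloid model\<close>

text \<open>The point of the hyperboloid over the disc point \<open>z\<close>; the last coordinate
  is \<open>cosh\<close> of the distance to the disc centre.\<close>

definition hv :: "hyp_plane \<Rightarrow> vec3" where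
  "hv p = (let z = Rep_hyp_plane p; q = 1 - (cmod z)\<^sup>2
           in (2 * Re z / q, 2 * Im z / q, (1 + (cmod z)\<^sup>2) / q))"

text \<open>Turns the Euclidean inner product into the Lorentz form with positive time coordinate,
  so that functionals stay ordinary vectors.\<close>

fun lorentz :: "vec3 \<Rightarrow> vec3" where "lorentz (x, y, z) = (- x, - y, z)"

lemma one_minus_norm_Rep_pos: "1 - (cmod (Rep_hyp_plane p))\<^sup>2 > 0"
  using norm_Rep_less[of p] by (simp add: abs_square_less_1)

lemma hv_pos: "(0, 0, 1) \<bullet> hv p > 0"
  using one_minus_norm_Rep_pos[of p] by (simp add: hv_def Let_def add_pos_nonneg)

lemma cosh_dist_hv: "cosh (dist a b) = lorentz (hv a) \<bullet> hv b"
proof -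
  have o: "to_origin (Abs_hyp_plane 0) z = Rep_hyp_plane z" for z
    by (simp add: to_origin_def Moebius_function_simple Abs_hyp_plane_inverse)
  show ?thesis
    unfolding cosh_dist_to_origin[of a b "Abs_hyp_plane 0"] o hv_def Let_def
    using one_minus_norm_Rep_pos[of a] one_minus_norm_Rep_pos[of b]
    by (simp add: inner_complex_def divide_simps)
qed

text \<open>The Lorentz square is 1 on the hyperboloid, so \<open>r\<^sup>2 = 1\<close>, and the
  upper sheet excludes \<open>r = - 1\<close>.\<close>

lemma hv_parallel_imp_eq:
  assumes "hv b = r *\<^sub>R hv a"
  shows "a = b"
proof -
  have l: "lorentz (r *\<^sub>R x) = r *\<^sub>R lorentz x" for x by (cases x) simp
  have "1 = lorentz (hv b) \<bullet> hv b" using cosh_dist_hv[of b b] by simp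
  also have "\<dots> = r\<^sup>2 * (lorentz (hv a) \<bullet> hv a)" by (simp add: assms l power2_eq_square)
  also have "\<dots> = r\<^sup>2" using cosh_dist_hv[of a a] by simp
  finally have r2: "r\<^sup>2 = 1" by simp
  have "r * ((0, 0, 1) \<bullet> hv a) > 0" using hv_pos[of b] unfolding assms by simp
  hence "r > 0" using hv_pos[of a] by (simp add: zero_less_mult_iff)
  hence "r = 1" using r2 by (simp add: power2_eq_1_iff)
  hence "hv b = hv a" using assms by simp
  hence "cosh (dist a b) = cosh (dist a a)" by (simp only: cosh_dist_hv)
  hence "dist a b = 0" using cosh_eq_cosh_nonneg[of "dist a b" "dist a a"] by simp
  thus ?thesis by simp
qed

lemma hv_klein_inj:
  assumes "fst (hv a) * snd (snd (hv b)) = fst (hv b) * snd (snd (hv a))"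
    "fst (snd (hv a)) * snd (snd (hv b)) = fst (snd (hv b)) * snd (snd (hv a))"
  shows "a = b"
proof (rule hv_parallel_imp_eq)
  have z: "snd (snd (hv a)) > 0" using hv_pos[of a] by (cases "hv a") simp
  show "hv b = (snd (snd (hv b)) / snd (snd (hv a))) *\<^sub>R hv a"
    using assms z by (cases "hv a"; cases "hv b") (simp add: divide_simps mult.commute)
qed

lemma cross_hv_nonzero: "a \<noteq> b \<Longrightarrow> cross (hv a) (hv b) \<noteq> 0"
  using hv_klein_inj[of a b] by (cases "hv a"; cases "hv b") (auto simp: zero_prod_def mult.commute)

text \<open>In the Klein coordinates \<open>X\<close>, \<open>Y\<close> each pair of distinct points
  rules out at most one slope \<open>\<tau>\<close>.\<close>

lemma exists_separating_slope:
  assumes "finite S"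
  obtains \<tau> where "inj_on (\<lambda>x. ((1, \<tau>, 0) \<bullet> hv x) / ((0, 0, 1) \<bullet> hv x)) S"
proof -
  define X Y where "X p = fst (hv p) / snd (snd (hv p))" and "Y p = fst (snd (hv p)) / snd (snd (hv p))" for p
  define bad where "bad = (\<lambda>(a, b). - (X a - X b) / (Y a - Y b)) ` (S \<times> S)"
  have "finite bad" using assms by (simp add: bad_def)
  then obtain \<tau> where \<tau>: "\<tau> \<notin> bad" using ex_new_if_finite[OF infinite_UNIV_char_0] by blast
  have z: "snd (snd (hv p)) > 0" for p using hv_pos[of p] by (cases "hv p") simp
  have eq: "((1, \<tau>, 0) \<bullet> hv x) / ((0, 0, 1) \<bullet> hv x) = X x + \<tau> * Y x" for x
    by (cases "hv x") (simp add: X_def Y_def add_divide_distrib)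
  have "inj_on (\<lambda>x. X x + \<tau> * Y x) S"
  proof (rule inj_onI, rule ccontr)
    fix a b assume ab: "a \<in> S" "b \<in> S" "X a + \<tau> * Y a = X b + \<tau> * Y b" "a \<noteq> b"
    show False
    proof (cases "Y a = Y b")
      case True
      hence "X a = X b" using ab by simp
      hence "a = b" using True z[of a] z[of b]
        by (intro hv_klein_inj) (simp_all add: X_def Y_def field_simps)
      thus False using ab by simp
    next
      case False
      hence "\<tau> = - (X a - X b) / (Y a - Y b)" using ab by (simp add: divide_simps) (simp add: algebra_simps)
      moreover have "(a, b) \<in> S \<times> S" using ab by simp
      ultimately have "\<tau> \<in> bad" unfolding bad_def by (metis (mono_tags, lifting) case_prod_conv image_eqI)
      thus False using \<tau> by simp
    qed
  qed
  thus ?thesis using that[of \<tau>] by (simp add: eq)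
qed

section \<open>A generic triangulation that contains all contacts\<close>

lemma exists_generic_lift:
  fixes S :: "hyp_plane set"
  assumes S: "finite S" and \<delta>: "\<delta> > 0"
    and sep: "\<And>u v. u \<in> S \<Longrightarrow> v \<in> S \<Longrightarrow> u \<noteq> v \<Longrightarrow> dist u v \<ge> \<delta>"
  obtains c \<rho> where "generic_lift S hv c \<rho> (0, 0, 1)"
    "\<And>u v. u \<in> S \<Longrightarrow> v \<in> S \<Longrightarrow> dist u v = \<delta> \<Longrightarrow> generic_lift.edge S hv c u v"
proof -
  define C where "C = cosh \<delta>"
  have C1: "C > 1" using \<delta> cosh_real_strict_mono[of 0 \<delta>] by (simp add: C_def)
  \<comment> \<open>Half of the gap between 1 and \<open>2 * C / (C + 1)\<close>, the lower bound
    for the contact functional below at a third point when all weights are 1.\<close>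
  define e where "e = (C - 1) / (2 * (1 + C))"
  have e: "e > 0" using C1 by (simp add: e_def)
  have e1: "1 + e < 2 * C / (C + 1)" using C1 less_1_mult[OF C1 C1] by (simp add: e_def divide_simps) (simp add: algebra_simps)
  have "C * 2 < C * (C + 1)" using C1 by simp
  hence "2 * C / (C + 1) < C" using C1 by (simp add: pos_divide_less_eq mult.commute del: mult_less_cancel_left_pos)
  hence e2: "1 + e < C" using e1 by simp
  obtain c where c: "\<forall>x\<in>S. 1 \<le> c x \<and> c x < 1 + e"
    and c3: "\<forall>l u v w. {u, v, w} \<subseteq> S \<longrightarrow> distinct [u, v, w] \<longrightarrow> l \<bullet> hv u = c u \<longrightarrow> l \<bullet> hv v = c v \<longrightarrow>
      l \<bullet> hv w = c w \<longrightarrow> det3 (hv u) (hv v) (hv w) \<noteq> 0"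
    and c4: "\<forall>l u v w x. {u, v, w, x} \<subseteq> S \<longrightarrow> distinct [u, v, w, x] \<longrightarrow> l \<bullet> hv u = c u \<longrightarrow>
      l \<bullet> hv v = c v \<longrightarrow> l \<bullet> hv w = c w \<longrightarrow> l \<bullet> hv x \<noteq> c x"
    using generic_weights[of S hv, OF S cross_hv_nonzero e] by blast
  note c = bspec[OF c]
  obtain \<tau> where \<tau>: "inj_on (\<lambda>x. ((1, \<tau>, 0) \<bullet> hv x) / ((0, 0, 1) \<bullet> hv x)) S"
    using exists_separating_slope[OF S] by blast
  have far: "cosh (dist u v) \<ge> C" if "u \<in> S" "v \<in> S" "u \<noteq> v" for u v
    unfolding C_def using sep[OF that] \<delta> by (intro cosh_real_nonneg_le_iff[THEN iffD2]) auto
  have gl: "generic_lift S hv c (1, \<tau>, 0) (0, 0, 1)"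
  proof
    show "finite S" by (rule S)
    show "l \<bullet> hv x \<noteq> c x" if "{u, v, w, x} \<subseteq> S" "distinct [u, v, w, x]"
      "l \<bullet> hv u = c u" "l \<bullet> hv v = c v" "l \<bullet> hv w = c w" for u v w x l
      using c4 that by blast
    show "det3 (hv u) (hv v) (hv w) \<noteq> 0" if "{u, v, w} \<subseteq> S" "distinct [u, v, w]"
      "l \<bullet> hv u = c u" "l \<bullet> hv v = c v" "l \<bullet> hv w = c w" for u v w l
      using c3 that by blast
    show "(0, 0, 1) \<bullet> hv x > 0" for x by (rule hv_pos)
    show "inj_on (\<lambda>x. ((1, \<tau>, 0) \<bullet> hv x) / ((0, 0, 1) \<bullet> hv x)) S" by (rule \<tau>)
  next
    fix v assume v: "v \<in> S"
    \<comment> \<open>The Lorentz functional of \<open>hv v\<close>, scaled to be tight at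
      \<open>v\<close>, is at least \<open>C\<close> at the other points, which exceeds all
      weights.\<close>
    have "c v * cosh (dist v x) > c x" if "x \<in> S - {v}" for x
    proof -
      have "c x < C" using c[of x] that e2 by auto
      also have "C \<le> cosh (dist v x)" using far[of v x] v that by auto
      also have "\<dots> \<le> c v * cosh (dist v x)"
        using c[OF v] mult_right_mono[of 1 "c v" "cosh (dist v x)"] by simp
      finally show ?thesis .
    qed
    thus "\<exists>l. l \<bullet> hv v = c v \<and> (\<forall>x\<in>S - {v}. c x < l \<bullet> hv x)"
      by (intro exI[of _ "c v *\<^sub>R lorentz (hv v)"]) (simp add: cosh_dist_hv[symmetric])
  qed
  have "generic_lift.edge S hv c u v" if uv: "u \<in> S" "v \<in> S" "dist u v = \<delta>" for u v
  proof -
    \<comment> \<open>The solution of the two tightness equations for a combination of the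
      functionals of \<open>u\<close> and \<open>v\<close>; nonnegativity lets the distance bound at
      a third point enter both terms.\<close>
    define \<alpha> \<beta> where "\<alpha> = (C * c v - c u) / (C\<^sup>2 - 1)" and "\<beta> = (C * c u - c v) / (C\<^sup>2 - 1)"
    have C2: "C\<^sup>2 - 1 > 0" using C1 by (simp add: one_less_power)
    have pos: "\<alpha> \<ge> 0" "\<beta> \<ge> 0"
    proof -
      have "C * 1 \<le> C * c v" "C * 1 \<le> C * c u" using c uv C1 by (auto intro!: mult_left_mono)
      hence "c u \<le> C * c v" "c v \<le> C * c u" using c[OF uv(1)] c[OF uv(2)] e2 by linarith+
      thus "\<alpha> \<ge> 0" "\<beta> \<ge> 0" using C2 by (simp_all add: \<alpha>_def \<beta>_def)
    qed
    have eq: "\<alpha> + \<beta> * C = c u" "\<alpha> * C + \<beta> = c v"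
      using C2 by (simp_all add: \<alpha>_def \<beta>_def divide_simps) (simp_all add: algebra_simps power2_eq_square)
    have "(\<alpha> + \<beta>) * (C + 1) = c u + c v" using eq by (simp add: algebra_simps)
    hence sum: "\<alpha> + \<beta> = (c u + c v) / (C + 1)" using C1 by (simp add: field_simps)
    define l where "l = \<alpha> *\<^sub>R lorentz (hv u) + \<beta> *\<^sub>R lorentz (hv v)"
    have l: "l \<bullet> hv x = \<alpha> * cosh (dist u x) + \<beta> * cosh (dist v x)" for x
      by (simp add: l_def inner_add_left cosh_dist_hv)
    have "l \<bullet> hv x > c x" if x: "x \<in> S - {u, v}" for x
    proof -
      have "c x < 2 * C / (C + 1)" using c[of x] x e1 by auto
      also have "\<dots> \<le> (c u + c v) * C / (C + 1)"
        using c[OF uv(1)] c[OF uv(2)] C1 by (intro divide_right_mono mult_right_mono) auto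
      also have "\<dots> = \<alpha> * C + \<beta> * C" using sum by (simp add: distrib_right[symmetric])
      also have "\<dots> \<le> \<alpha> * cosh (dist u x) + \<beta> * cosh (dist v x)"
        using far[of u x] far[of v x] uv x pos by (intro add_mono mult_left_mono) auto
      finally show ?thesis by (simp add: l)
    qed
    moreover have "l \<bullet> hv u = c u" "l \<bullet> hv v = c v"
      using eq uv by (simp_all add: l C_def dist_commute)
    ultimately have "generic_lift.supports S hv c l {u, v}"
      using uv by (auto simp: generic_lift.supports_def[OF gl])
    moreover have "u \<noteq> v" using uv \<delta> by auto
    ultimately show ?thesis by (auto simp: generic_lift.edge_def[OF gl])
  qed
  thus ?thesis using that[OF gl] by blast
qed

text \<open>Both quantities tell on which side of the geodesic from \<open>v\<close> through
  \<open>u\<close> the point \<open>w\<close> lies: the determinant by a plane through the origin,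
  the quotient by directions after \<open>v\<close> is moved to the disc centre. The positive factor
  is computed explicitly.\<close>

lemma det3_hv:
  assumes "u \<noteq> v"
  obtains \<kappa> where "\<kappa> > 0" "det3 (hv v) (hv u) (hv w) = \<kappa> * Im (to_origin v w / to_origin v u)"
proof -
  define a b d where "a = Rep_hyp_plane v" and "b = Rep_hyp_plane u" and "d = Rep_hyp_plane w"
  have lt: "cmod a < 1" "cmod b < 1" "cmod d < 1" by (simp_all add: a_def b_def d_def norm_Rep_less)
  define A B where "A = 1 - cnj a * b" and "B = 1 - cnj a * d"
  have nz: "A \<noteq> 0" "B \<noteq> 0" unfolding A_def B_def using lt one_minus_cnj_mult_nonzero by auto
  have ba: "b - a \<noteq> 0" using assms by (simp add: a_def b_def Rep_hyp_plane_inject)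
  define qa qb qd where "qa = 1 - (cmod a)\<^sup>2" and "qb = 1 - (cmod b)\<^sup>2" and "qd = 1 - (cmod d)\<^sup>2"
  have q: "qa > 0" "qb > 0" "qd > 0"
    unfolding qa_def qb_def qd_def a_def b_def d_def by (rule one_minus_norm_Rep_pos)+
  define M where "M = Im ((d - a) * cnj (b - a) * (cnj B * A))"
  have sq: "(cmod x)\<^sup>2 = Re x * Re x + Im x * Im x" for x by (simp add: cmod_power2 flip: power2_eq_square)
  have eq: "qa * (qa * qb * qd * det3 (hv v) (hv u) (hv w)) = 4 * M"
  proof -
    have 1: "(hv v) = (2 * Re a / qa, 2 * Im a / qa, (1 + (cmod a)\<^sup>2) / qa)"
      "(hv u) = (2 * Re b / qb, 2 * Im b / qb, (1 + (cmod b)\<^sup>2) / qb)"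
      "(hv w) = (2 * Re d / qd, 2 * Im d / qd, (1 + (cmod d)\<^sup>2) / qd)"
      by (simp_all add: hv_def Let_def a_def b_def d_def qa_def qb_def qd_def)
    have 2: "det3 (x1 / qa, y1 / qa, z1 / qa) (x2 / qb, y2 / qb, z2 / qb) (x3 / qd, y3 / qd, z3 / qd)
      = det3 (x1, y1, z1) (x2, y2, z2) (x3, y3, z3) / (qa * qb * qd)" for x1 x2 x3 y1 y2 y3 z1 z2 z3
      using q by (simp add: det3_def divide_simps)
    have 3: "qa * qb * qd * det3 (hv v) (hv u) (hv w) = det3 (2 * Re a, 2 * Im a, 1 + (cmod a)\<^sup>2)
      (2 * Re b, 2 * Im b, 1 + (cmod b)\<^sup>2) (2 * Re d, 2 * Im d, 1 + (cmod d)\<^sup>2)"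
      unfolding 1 2 using q by simp
    \<comment> \<open>Differences to \<open>a\<close> expose the factor \<open>Q\<close>: all terms
      of the product but the last contain it, and the last one is real.\<close>
    define Q \<beta> \<gamma> where "Q = 1 - a * cnj a" and "\<beta> = b - a" and "\<gamma> = d - a"
    have Q: "Q = of_real qa" by (simp add: Q_def qa_def complex_norm_square del: of_real_power)
    have "(d - a) * cnj (b - a) * (cnj B * A)
      = \<gamma> * cnj \<beta> * ((Q - a * cnj \<gamma>) * (Q - cnj a * \<beta>))"
      by (simp add: \<beta>_def \<gamma>_def Q_def A_def B_def algebra_simps)
    also have "\<dots> = Q * (Q * \<gamma> * cnj \<beta> - a * (\<gamma> * cnj \<gamma>) * cnj \<beta> - cnj a * (\<beta> * cnj \<beta>) * \<gamma>)
      + (a * cnj a) * (\<beta> * cnj \<beta>) * (\<gamma> * cnj \<gamma>)"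
      by (simp add: algebra_simps)
    finally have "M = qa * Im (Q * \<gamma> * cnj \<beta> - a * (\<gamma> * cnj \<gamma>) * cnj \<beta> - cnj a * (\<beta> * cnj \<beta>) * \<gamma>)"
      unfolding M_def Q complex_mult_cnj by simp
    moreover have "det3 (2 * Re a, 2 * Im a, 1 + (cmod a)\<^sup>2)
      (2 * Re b, 2 * Im b, 1 + (cmod b)\<^sup>2) (2 * Re d, 2 * Im d, 1 + (cmod d)\<^sup>2)
      = 4 * Im (Q * \<gamma> * cnj \<beta> - a * (\<gamma> * cnj \<gamma>) * cnj \<beta> - cnj a * (\<beta> * cnj \<beta>) * \<gamma>)"
      by (simp add: det3_def sq Q_def \<beta>_def \<gamma>_def algebra_simps)
    ultimately show ?thesis unfolding 3 by simp
  qed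
  have "to_origin v w / to_origin v u = ((d - a) / B) / ((b - a) / A)"
    by (simp add: to_origin_def Moebius_function_simple a_def b_def d_def A_def B_def)
  also have "\<dots> = (d - a) * A / ((b - a) * B)" using nz ba by (simp add: field_simps)
  also have "\<dots> = (d - a) * cnj (b - a) * (cnj B * A) / of_real ((cmod ((b - a) * B))\<^sup>2)"
  proof -
    have "complex_of_real ((cmod ((b - a) * B))\<^sup>2) = ((b - a) * B) * (cnj (b - a) * cnj B)"
      by (simp add: complex_norm_square del: of_real_power)
    thus ?thesis using nz ba by (simp add: divide_simps)
  qed
  finally have im: "Im (to_origin v w / to_origin v u) = M / (cmod ((b - a) * B))\<^sup>2"
    by (simp add: M_def Im_divide_of_real del: of_real_power)
  define R where "R = (cmod ((b - a) * B))\<^sup>2"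
  have R: "R > 0" using nz ba by (simp add: R_def)
  show ?thesis
  proof
    show "4 * R / (qa * qa * qb * qd) > 0" using q R by simp
    show "det3 (hv v) (hv u) (hv w) = 4 * R / (qa * qa * qb * qd) * Im (to_origin v w / to_origin v u)"
      unfolding im R_def[symmetric] using eq q R by (simp add: field_simps)
  qed
qed

section \<open>Angles of hyperbolic triangles\<close>

lemma Re_to_origin_quotient:
  assumes "u \<noteq> v" "w \<noteq> v"
  shows "Re (to_origin v w / to_origin v u) = cos (hyp_angle u v w) * cmod (to_origin v w / to_origin v u)"
proof -
  define x y where "x = to_origin v u" and "y = to_origin v w"
  have nz: "x \<noteq> 0" "y \<noteq> 0" using assms by (auto simp: x_def y_def to_origin_eq_0_iff)
  have "\<bar>(x \<bullet> y) / (norm x * norm y)\<bar> \<le> 1"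
    using Cauchy_Schwarz_ineq2[of x y] nz by (simp add: divide_simps abs_mult)
  hence "cos (hyp_angle u v w) = (x \<bullet> y) / (norm x * norm y)"
    by (simp add: hyp_angle_def x_def y_def cos_arccos_abs)
  moreover have "Re (y / x) = (x \<bullet> y) / (cmod x)\<^sup>2"
    by (simp add: Re_divide inner_complex_def cmod_power2 algebra_simps)
  ultimately show ?thesis
    using nz unfolding x_def[symmetric] y_def[symmetric] by (simp add: norm_divide power2_eq_square)
qed

lemma Arg2pi_upper_add:
  assumes "Im a > 0" "Im b > 0"
  shows "Arg2pi (a * b) = Arg2pi a + Arg2pi b"
proof -
  have "Arg2pi a < pi" "Arg2pi b < pi" using assms Arg2pi_lt_pi by blast+
  moreover have "a \<noteq> 0" "b \<noteq> 0" using assms by auto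
  ultimately show ?thesis by (subst Arg2pi_times) auto
qed

text \<open>These are the angles of the triangle with vertices 0, 1 and \<open>z\<close>. The three
  quotients multiply to \<open>- 1\<close>, so the sum is an odd multiple of \<open>pi\<close>, and
  it is below \<open>3 * pi\<close>.\<close>

lemma euclidean_angle_sum:
  assumes "Im z > 0"
  shows "Arg2pi z + Arg2pi (1 / (1 - z)) + Arg2pi ((z - 1) / z) = pi"
    and "Im (1 / (1 - z)) > 0" and "Im ((z - 1) / z) > 0"
proof -
  have nz: "z \<noteq> 0" "z \<noteq> 1" using assms by auto
  have nz': "(Re z)\<^sup>2 + (Im z)\<^sup>2 > 0" "(1 - Re z)\<^sup>2 + (Im z)\<^sup>2 > 0"
    using assms by (simp_all add: add_nonneg_pos)
  show im1: "Im (1 / (1 - z)) > 0" using assms nz' by (simp add: Im_divide)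
  have "Im ((z - 1) / z) = Im z / ((Re z)\<^sup>2 + (Im z)\<^sup>2)"
    by (simp add: Im_divide algebra_simps)
  thus im2: "Im ((z - 1) / z) > 0" using assms nz' by simp
  define s where "s = Arg2pi (z * (1 / (1 - z)))"
  have s: "s = Arg2pi z + Arg2pi (1 / (1 - z))"
    unfolding s_def by (rule Arg2pi_upper_add[OF assms im1])
  have "s + Arg2pi ((z - 1) / z)
      = (if s + Arg2pi ((z - 1) / z) < 2 * pi then Arg2pi (- 1) else Arg2pi (- 1) + 2 * pi)"
  proof -
    have eq: "z * (1 / (1 - z)) * ((z - 1) / z) = - 1" using nz by (simp add: divide_simps)
    have "z * (1 / (1 - z)) \<noteq> 0" "(z - 1) / z \<noteq> 0" using nz by auto
    from Arg2pi_add[OF this] show ?thesis unfolding s_def eq .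
  qed
  moreover have "Arg2pi (- 1) = pi" using Arg2pi_of_real[of "- 1"] by simp
  moreover have "Arg2pi z < pi" "Arg2pi (1 / (1 - z)) < pi" "Arg2pi ((z - 1) / z) < pi"
    using assms im1 im2 Arg2pi_lt_pi by blast+
  ultimately show "Arg2pi z + Arg2pi (1 / (1 - z)) + Arg2pi ((z - 1) / z) = pi"
    using s by (auto split: if_splits)
qed

text \<open>Moving the disc by \<open>c\<close> changes the chart at \<open>a\<close> by a
  unimodular factor that depends on \<open>a\<close> and \<open>c\<close> alone and cancels in the
  quotient: oriented angles are invariant.\<close>

lemma Moebius_quotient:
  assumes "cmod a < 1" "cmod b < 1" "cmod c < 1" "cmod d < 1"
  shows "Moebius_function 0 (Moebius_function 0 c a) (Moebius_function 0 c b)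
       / Moebius_function 0 (Moebius_function 0 c a) (Moebius_function 0 c d)
     = Moebius_function 0 a b / Moebius_function 0 a d"
proof -
  have key: "Moebius_function 0 (Moebius_function 0 c a) (Moebius_function 0 c b)
      = cnj (1 - cnj c * a) / (1 - cnj c * a) * Moebius_function 0 a b" if "cmod b < 1" for b
  proof -
    define k where "k = 1 - c * cnj c"
    define A where "A = 1 - cnj c * a"
    define B where "B = 1 - cnj c * b"
    have nz: "A \<noteq> 0" "B \<noteq> 0" "1 - cnj a * b \<noteq> 0"
      unfolding A_def B_def using assms that one_minus_cnj_mult_nonzero by auto
    have k: "k \<noteq> 0"
      unfolding k_def using one_minus_cnj_mult_nonzero[of c c] assms by (simp add: mult.commute)
    have num: "(b - c) / B - (a - c) / A = k * (b - a) / (A * B)"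
      using nz(1,2) by (simp add: divide_simps) (simp add: A_def B_def k_def algebra_simps)
    have den: "1 - cnj ((a - c) / A) * ((b - c) / B) = k * (1 - cnj a * b) / (cnj A * B)"
      using nz(1,2) by (simp add: divide_simps) (simp add: A_def B_def k_def algebra_simps)
    have "Moebius_function 0 (Moebius_function 0 c a) (Moebius_function 0 c b)
          = ((b - c) / B - (a - c) / A) / (1 - cnj ((a - c) / A) * ((b - c) / B))"
      unfolding Moebius_function_simple A_def B_def ..
    also have "\<dots> = (k * (b - a) / (A * B)) / (k * (1 - cnj a * b) / (cnj A * B))"
      unfolding num den ..
    also have "\<dots> = cnj A / A * ((b - a) / (1 - cnj a * b))"
      using nz k by (simp add: divide_simps)
    finally show ?thesis unfolding A_def Moebius_function_simple .
  qed
  have "1 - cnj c * a \<noteq> 0" using one_minus_cnj_mult_nonzero assms by auto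
  hence "cnj (1 - cnj c * a) / (1 - cnj c * a) \<noteq> 0"
    unfolding divide_eq_0_iff complex_cnj_zero_iff by simp
  thus ?thesis unfolding key[OF assms(2)] key[OF assms(4)] by (rule mult_divide_mult_cancel_left)
qed

text \<open>
  After moving \<open>a\<close> to the origin, the two other angles are smaller than those of the Euclidean
  triangle with the same vertices, both by the argument of \<open>1 - \<beta> * cnj \<gamma>\<close>.
\<close>

lemma hyperbolic_angle_sum:
  fixes a b c :: hyp_plane
  assumes im: "Im (to_origin a c / to_origin a b) > 0" "Im (to_origin b a / to_origin b c) > 0"
    "Im (to_origin c b / to_origin c a) > 0"
  shows "Arg2pi (to_origin a c / to_origin a b) + Arg2pi (to_origin b a / to_origin b c)
    + Arg2pi (to_origin c b / to_origin c a) \<le> pi"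
proof -
  define \<beta> \<gamma> z where "\<beta> = to_origin a b" and "\<gamma> = to_origin a c" and "z = \<gamma> / \<beta>"
  have lt: "cmod \<beta> < 1" "cmod \<gamma> < 1" by (simp_all add: \<beta>_def \<gamma>_def norm_to_origin_less)
  have nz: "\<beta> \<noteq> 0" "\<gamma> \<noteq> 0" using im(1) by (auto simp: \<beta>_def \<gamma>_def)
  have z: "Im z > 0" using im(1) by (simp add: z_def \<beta>_def \<gamma>_def)
  hence "z \<noteq> 1" by auto
  hence bg: "\<beta> \<noteq> \<gamma>" using nz by (auto simp: z_def)
  have aa: "to_origin a a = 0" by (simp add: to_origin_eq_0_iff)
  have q: "Moebius_function 0 (to_origin a x) (to_origin a y) / Moebius_function 0 (to_origin a x) (to_origin a w)
      = to_origin x y / to_origin x w" for x y w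
    unfolding to_origin_def by (intro Moebius_quotient norm_Rep_less)
  define \<omega> where "\<omega> = 1 - \<beta> * cnj \<gamma>"
  have \<omega>: "\<omega> \<noteq> 0" "cnj \<omega> = 1 - cnj \<beta> * \<gamma>" "1 - cnj \<gamma> * \<beta> = \<omega>"
    using one_minus_cnj_mult_nonzero[OF lt(2,1)] by (simp_all add: \<omega>_def mult.commute)
  have "\<omega> = 1 - cnj z * of_real ((cmod \<beta>)\<^sup>2)"
    using nz by (simp add: \<omega>_def z_def complex_norm_square del: of_real_power)
  hence im\<omega>: "Im \<omega> > 0" using z nz by (simp del: of_real_power)
  have "to_origin b a / to_origin b c = (- \<beta>) / ((\<gamma> - \<beta>) / cnj \<omega>)"
    using q[of b a c] unfolding aa \<beta>_def[symmetric] \<gamma>_def[symmetric]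
    by (simp add: Moebius_function_simple \<omega>)
  hence "to_origin b a / to_origin b c * \<omega> = - \<beta> / ((\<gamma> - \<beta>) / cnj \<omega>) * \<omega>" by simp
  also have "\<dots> = \<beta> / (\<beta> - \<gamma>) * (\<omega> * cnj \<omega>)"
  proof -
    have "- b / ((g - b) / w') * w = b / (b - g) * (w * w')" if "b \<noteq> g" "w' \<noteq> 0" for b g w w' :: complex
      using that by (simp add: divide_simps) (simp add: algebra_simps)
    thus ?thesis using bg \<omega>(1) by simp
  qed
  also have "\<beta> / (\<beta> - \<gamma>) = 1 / (1 - z)" using nz bg by (simp add: z_def divide_simps)
  also have "\<omega> * cnj \<omega> = of_real ((cmod \<omega>)\<^sup>2)" by (rule complex_norm_square[symmetric])
  finally have "to_origin b a / to_origin b c * \<omega> = 1 / (1 - z) * of_real ((cmod \<omega>)\<^sup>2)" .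
  moreover have "(cmod \<omega>)\<^sup>2 > 0" using \<omega>(1) by simp
  ultimately have B: "Arg2pi (to_origin b a / to_origin b c) + Arg2pi \<omega> = Arg2pi (1 / (1 - z))"
    using Arg2pi_upper_add[OF im(2) im\<omega>] Arg2pi_times_of_real2[of "(cmod \<omega>)\<^sup>2" "1 / (1 - z)"] by simp
  have "to_origin c b / to_origin c a = ((\<beta> - \<gamma>) / \<omega>) / (- \<gamma>)"
    using q[of c b a] unfolding aa \<beta>_def[symmetric] \<gamma>_def[symmetric]
    by (simp add: Moebius_function_simple \<omega>)
  hence "to_origin c b / to_origin c a * \<omega> = (\<beta> - \<gamma>) / \<omega> / (- \<gamma>) * \<omega>" by simp
  also have "\<dots> = (\<gamma> - \<beta>) / \<gamma>" using nz \<omega>(1) by (simp add: divide_simps)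
  also have "\<dots> = (z - 1) / z" using nz by (simp add: z_def divide_simps)
  finally have "to_origin c b / to_origin c a * \<omega> = (z - 1) / z" .
  hence C: "Arg2pi (to_origin c b / to_origin c a) + Arg2pi \<omega> = Arg2pi ((z - 1) / z)"
    using Arg2pi_upper_add[OF im(3) im\<omega>] by simp
  have "Arg2pi \<omega> \<ge> 0" by (rule Arg2pi_ge_0)
  thus ?thesis
    using B C euclidean_angle_sum(1)[OF z] unfolding z_def \<beta>_def \<gamma>_def by linarith
qed

section \<open>Contacts at the side length of the triangles with angles \<open>2 pi / 7\<close>\<close>

definition side7 :: real where "side7 = equilateral_side (2 * pi / 7)"

lemma side7: "side7 > 0" "cosh side7 > 1" "cosh side7 * (1 - cos (2 * pi / 7)) = cos (2 * pi / 7)"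
proof -
  have a: "0 < 2 * pi / 7" "2 * pi / 7 < pi / 3" by simp_all
  show pos: "side7 > 0" unfolding side7_def by (rule equilateral_side_eq(2)[OF a])
  thus "cosh side7 > 1" using cosh_real_strict_mono[of 0 side7] by simp
  obtain x y z where "equilateral_triangle side7 (2 * pi / 7) x y z"
    using equilateral_side_eq(3)[OF a] by (auto simp: side7_def)
  hence "cosh side7 = cos (2 * pi / 7) / (1 - cos (2 * pi / 7))" by (rule equilateral_triangle_imp_cosh)
  moreover have "cos (2 * pi / 7) < 1" using cos_monotone_0_pi[of 0 "2 * pi / 7"] by simp
  ultimately show "cosh side7 * (1 - cos (2 * pi / 7)) = cos (2 * pi / 7)" by simp
qed

text \<open>For two legs of length \<open>side7\<close> the law of cosines makes the cosine at the
  apex decrease with the base, and at base \<open>side7\<close> it is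
  \<open>cos (2 * pi / 7)\<close>.\<close>

lemma cos_angle_le:
  assumes "dist v u = side7" "dist v w = side7" "dist u w \<ge> side7"
  shows "cos (hyp_angle u v w) \<le> cos (2 * pi / 7)"
proof -
  define C t where "C = cosh side7" and "t = cos (hyp_angle u v w)"
  have C: "C > 1" "C * (1 - cos (2 * pi / 7)) = cos (2 * pi / 7)" using side7 by (auto simp: C_def)
  have ne: "u \<noteq> v" "w \<noteq> v" using assms side7(1) by auto
  have "C \<le> cosh (dist u w)"
    unfolding C_def using assms(3) side7(1) by (intro cosh_real_nonneg_le_iff[THEN iffD2]) auto
  also have "\<dots> = C * C - sinh side7 * sinh side7 * t"
    using hyperbolic_law_of_cosines[OF ne] assms by (simp add: C_def t_def dist_commute)
  also have "sinh side7 * sinh side7 = C * C - 1"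
    using cosh_square_eq[of side7] by (simp add: C_def power2_eq_square)
  finally have "(C - 1) * ((C + 1) * t) \<le> (C - 1) * C" by (simp add: algebra_simps)
  hence "(C + 1) * t \<le> C" using C by simp
  also have "C = (C + 1) * cos (2 * pi / 7)" using C(2) by (simp add: algebra_simps)
  finally show ?thesis using C(1) by (simp add: t_def)
qed

lemma unit_triangle_angle:
  assumes "dist v u = side7" "dist u w = side7" "dist w v = side7"
    and im: "Im (to_origin v w / to_origin v u) > 0"
  shows "Arg2pi (to_origin v w / to_origin v u) = 2 * pi / 7"
proof -
  define q where "q = to_origin v w / to_origin v u"
  define C where "C = cosh side7"
  have ne: "u \<noteq> v" "w \<noteq> v" using assms side7(1) by auto
  have "C * (1 - cos (hyp_angle u v w)) = cos (hyp_angle u v w)"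
    unfolding C_def using equilateral_cosines[of side7 u v w] assms side7(1) by (simp add: dist_commute)
  hence "(C + 1) * (cos (hyp_angle u v w) - cos (2 * pi / 7)) = 0"
    using side7(3) by (simp add: C_def algebra_simps)
  hence "cos (hyp_angle u v w) = cos (2 * pi / 7)" using side7(2) by (simp add: C_def)
  moreover have "cmod q * cos (Arg2pi q) = cmod q * cos (hyp_angle u v w)"
    using Re_to_origin_quotient[OF ne] by (simp add: cos_Arg2pi q_def mult.commute)
  moreover have "q \<noteq> 0" using im by (auto simp: q_def)
  ultimately have "cos (Arg2pi q) = cos (2 * pi / 7)" by simp
  moreover have "0 < Arg2pi q \<and> Arg2pi q < pi" using im Arg2pi_lt_pi by (simp add: q_def)
  ultimately show ?thesis
    unfolding q_def[symmetric] using cos_inj_pi[of "Arg2pi q" "2 * pi / 7"] by simp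
qed

definition contact_darts :: "hyp_plane set \<Rightarrow> (hyp_plane \<times> hyp_plane) set" where
  "contact_darts S = {(p, q). p \<in> S \<and> q \<in> S \<and> dist p q = side7}"

lemma exists_seven_lift:
  fixes S :: "hyp_plane set"
  assumes S: "finite S"
    and sep: "\<And>u v. u \<in> S \<Longrightarrow> v \<in> S \<Longrightarrow> u \<noteq> v \<Longrightarrow> dist u v \<ge> side7"
  obtains c \<rho> where "seven_lift S hv c \<rho> (0, 0, 1) to_origin (contact_darts S)"
proof -
  obtain c \<rho> where gl: "generic_lift S hv c \<rho> (0, 0, 1)"
    and edges: "\<And>u v. u \<in> S \<Longrightarrow> v \<in> S \<Longrightarrow> dist u v = side7 \<Longrightarrow> generic_lift.edge S hv c u v"
    using exists_generic_lift[OF S side7(1) sep] by metis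
  interpret generic_lift S hv c \<rho> "(0, 0, 1)" by (rule gl)
  interpret directed_lift S hv c \<rho> "(0, 0, 1)" to_origin
  proof
    show "to_origin v u \<noteq> 0" if "u \<noteq> v" for v u using that by (simp add: to_origin_eq_0_iff)
    show "\<exists>\<kappa>>0. det3 (hv v) (hv u) (hv w) = \<kappa> * Im (to_origin v w / to_origin v u)"
      if "u \<noteq> v" for v u w using det3_hv[of u v w] that by metis
  qed
  have im: "Im (to_origin v w / to_origin v u) > 0" if "tri v u w" for v u w
    using ang_pos[OF that] Arg2pi_lt_pi unfolding ang_def by blast
  have "seven_lift S hv c \<rho> (0, 0, 1) to_origin (contact_darts S)"
  proof
    show "contact_darts S \<subseteq> darts" using edges by (auto simp: contact_darts_def darts_def)
    show "(u, v) \<in> contact_darts S" if "(v, u) \<in> contact_darts S" for v u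
      using that by (auto simp: contact_darts_def dist_commute)
    show "Re (to_origin v w / to_origin v u) \<le> cos (2 * pi / 7) * cmod (to_origin v w / to_origin v u)"
      if "(v, u) \<in> contact_darts S" "(v, w) \<in> contact_darts S" "u \<noteq> w" for v u w
    proof -
      have "dist v u = side7" "dist v w = side7" "u \<noteq> v" "w \<noteq> v" "dist u w \<ge> side7"
        using that side7(1) sep by (auto simp: contact_darts_def)
      thus ?thesis
        unfolding Re_to_origin_quotient[OF \<open>u \<noteq> v\<close> \<open>w \<noteq> v\<close>] by (intro mult_right_mono cos_angle_le) auto
    qed
    show "ang v u w + ang u w v + ang w v u \<le> pi" if "tri v u w" for v u w
      unfolding ang_def using that tri_rotate by (intro hyperbolic_angle_sum im) blast+
    show "ang v u w = 2 * pi / 7" if "tri v u w" "(v, u) \<in> contact_darts S"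
      "(u, w) \<in> contact_darts S" "(w, v) \<in> contact_darts S" for v u w
      unfolding ang_def using that im by (intro unit_triangle_angle) (auto simp: contact_darts_def)
  qed
  thus ?thesis using that by blast
qed

section \<open>The recursion for the bound\<close>

text \<open>For \<open>t = 0\<close> and equality in the recursion, removing a boundary layer
  preserves \<open>5 / 4 * (n + 6)\<^sup>2 - (7 / 2 * n - e)\<^sup>2\<close>. The bound sets this
  quantity to 49, its value for one point without contacts.\<close>

definition contact_bound :: "real \<Rightarrow> real" where
  "contact_bound n = 7 / 2 * n - sqrt (5 / 4 * n\<^sup>2 + 15 * n - 4)"

lemma contact_bound_quadratic:
  "5 / 4 * n\<^sup>2 + 15 * n - 4 = 5 / 4 * (n + 6)\<^sup>2 - (49 :: real)"
  by (simp add: power2_eq_square algebra_simps)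

lemma contact_boundI:
  assumes "0 \<le> q" "5 / 4 * (n + 6)\<^sup>2 - 49 \<le> q\<^sup>2"
  shows "7 / 2 * n - q \<le> contact_bound n"
proof -
  have "sqrt (5 / 4 * n\<^sup>2 + 15 * n - 4) \<le> sqrt (q\<^sup>2)"
    unfolding contact_bound_quadratic using assms(2) by (rule real_sqrt_le_mono)
  thus ?thesis using assms(1) by (simp add: contact_bound_def)
qed

text \<open>
  The recursion is exact for \<open>t = 0\<close>, and \<open>t\<close> only helps because \<open>(sqrt 5 - 1) / 2\<close>, an upper
  bound for \<open>(h + t) / (n + 6)\<close> if the claim fails, is less than \<open>7 / 11\<close>.
\<close>

lemma contact_bound_step:
  fixes n h t e :: real
  assumes nonneg: "0 \<le> t" "0 \<le> h" "h \<le> n" "1 \<le> n - h"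
    and e: "e = 3 * n - 3 - h - t"
    and step: "e \<le> contact_bound (n - h) + 4 * h - n - 6 + 3 / 2 * t"
  shows "e \<le> contact_bound n"
proof -
  \<comment> \<open>The recursion says \<open>sqrt Q \<le> p\<close>, and
    \<open>e = 7 / 2 * n - q\<close>, so the claim is that \<open>q\<close> is at least the root at
    \<open>n\<close>; \<open>n + 6\<close> completes the square.\<close>
  define a p q where "a = n + 6" and "p = 3 / 2 * h + 5 / 2 * t - a / 2" and "q = a / 2 + h + t"
  have a: "a > 0" using nonneg by (simp add: a_def)
  have "5 / 4 * a\<^sup>2 - 49 \<le> q\<^sup>2"
  proof (rule ccontr)
    assume neg: "\<not> 5 / 4 * a\<^sup>2 - 49 \<le> q\<^sup>2"
    have "h + t \<le> 7 / 11 * a"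
    proof (rule ccontr)
      assume "\<not> h + t \<le> 7 / 11 * a"
      hence "(25 / 22 * a)\<^sup>2 \<le> q\<^sup>2" using a by (intro power_mono) (auto simp: q_def)
      moreover have "(25 / 22 * a)\<^sup>2 = 625 / 484 * a\<^sup>2" by (simp add: power2_eq_square)
      moreover have "a\<^sup>2 \<ge> 0" by simp
      ultimately show False using neg by linarith
    qed
    hence "0 \<le> 7 / 2 * a - 11 / 2 * h - 21 / 4 * t" using nonneg by linarith
    hence t: "0 \<le> t * (7 / 2 * a - 11 / 2 * h - 21 / 4 * t)" using nonneg by simp
    define Q where "Q = 5 / 4 * (n - h)\<^sup>2 + 15 * (n - h) - 4"
    have sq: "sqrt Q \<le> p"
      using step unfolding contact_bound_def e p_def a_def Q_def by argo
    have "Q \<ge> 0"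
    proof -
      have "0 \<le> 5 / 4 * d\<^sup>2 + 15 * d - 4" if "1 \<le> d" for d :: real
        using zero_le_power2[of d] that by linarith
      thus ?thesis unfolding Q_def using nonneg(4) by blast
    qed
    hence "Q \<le> p\<^sup>2" using sq by (metis real_sqrt_ge_zero real_sqrt_pow2 power_mono)
    hence "5 / 4 * (a - h)\<^sup>2 - 49 \<le> p\<^sup>2"
      unfolding Q_def contact_bound_quadratic by (simp add: a_def algebra_simps)
    moreover have "q\<^sup>2 - p\<^sup>2 - (5 / 4 * a\<^sup>2 - 5 / 4 * (a - h)\<^sup>2) = t * (7 / 2 * a - 11 / 2 * h - 21 / 4 * t)"
      by (simp add: p_def q_def power2_eq_square field_simps)
    ultimately show False using t neg by linarith
  qed
  moreover have "q \<ge> 0" using a nonneg by (simp add: q_def)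
  ultimately have "7 / 2 * n - q \<le> contact_bound n" by (intro contact_boundI) (auto simp: a_def)
  thus ?thesis unfolding e q_def a_def by argo
qed

lemma contact_bound_outerplanar:
  assumes "1 \<le> n" shows "2 * n - 3 \<le> contact_bound n"
proof -
  have "0 \<le> (n - 3)\<^sup>2" by simp
  hence "5 / 4 * (n + 6)\<^sup>2 - 49 \<le> (3 / 2 * n + 3)\<^sup>2"
    by (simp add: power2_eq_square algebra_simps)
  hence "7 / 2 * n - (3 / 2 * n + 3) \<le> contact_bound n" using assms by (intro contact_boundI) auto
  thus ?thesis by argo
qed

text \<open>Covers collinear points. The difference of squares is
  \<open>5 * (n - 1)\<^sup>2\<close>, so equality holds at \<open>n = 1\<close>.\<close>

lemma contact_bound_path:
  assumes "1 \<le> n" shows "n - 1 \<le> contact_bound n"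
proof -
  have "0 \<le> (n - 1)\<^sup>2" by simp
  hence "5 / 4 * (n + 6)\<^sup>2 - 49 \<le> (5 / 2 * n + 1)\<^sup>2"
    by (simp add: power2_eq_square algebra_simps)
  hence "7 / 2 * n - (5 / 2 * n + 1) \<le> contact_bound n" using assms by (intro contact_boundI) auto
  thus ?thesis by argo
qed

lemma contact_bound_sparse:
  assumes "0 \<le> n" shows "7 / 3 * n - 7 \<le> contact_bound n"
proof -
  have "(7 / 6 * n + 7)\<^sup>2 - (5 / 4 * (n + 6)\<^sup>2 - 49) = 1 / 9 * n\<^sup>2 + 4 / 3 * n + 53"
    by (simp add: power2_eq_square field_simps)
  moreover have "0 \<le> 1 / 9 * n\<^sup>2 + 4 / 3 * n + 53" using assms by simp
  ultimately have "5 / 4 * (n + 6)\<^sup>2 - 49 \<le> (7 / 6 * n + 7)\<^sup>2" by linarith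
  hence "7 / 2 * n - (7 / 6 * n + 7) \<le> contact_bound n" using assms by (intro contact_boundI) auto
  thus ?thesis by argo
qed

section \<open>Induction over boundary layers\<close>

lemma card_contact_darts_le:
  assumes "finite S" "S \<noteq> {}"
    and "\<And>u v. u \<in> S \<Longrightarrow> v \<in> S \<Longrightarrow> u \<noteq> v \<Longrightarrow> dist u v \<ge> side7"
  shows "real (card (contact_darts S)) / 2 \<le> contact_bound (real (card S))"
  using assms
proof (induction "card S" arbitrary: S rule: less_induct)
  case less
  note S = less.prems
  let ?G = "contact_darts S"
  have n1: "1 \<le> real (card S)" using S by (simp add: Suc_leI card_gt_0_iff)
  obtain c \<rho> where "seven_lift S hv c \<rho> (0, 0, 1) to_origin ?G"
    using exists_seven_lift[OF S(1) S(3)] by metis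
  then interpret seven_lift S hv c \<rho> "(0, 0, 1)" to_origin ?G .
  show ?case
  proof (cases "tris = {}")
    case True
    hence "real (card ?G) / 2 \<le> real (card S) - 1" using card_G_collinear S(2) by simp
    thus ?thesis using contact_bound_path[OF n1] by linarith
  next
    case tris: False
    define n h t e where "n = real (card S)" and "h = real (card sources)"
      and "t = real (card (darts - ?G)) / 2" and "e = real (card ?G) / 2"
    have e: "e = 3 * n - 3 - h - t"
      using card_G[OF tris] by (simp add: n_def h_def t_def e_def)
    have hn: "card sources \<le> card S" by (rule card_mono[OF finite_S sources_subset])
    let ?T = "{(v, u) \<in> ?G. v \<in> sources \<or> u \<in> sources}"
    have touch: "real (card ?T) / 2 \<le> 4 * h - n - 6 + 3 / 2 * t"
      using touching_sources[OF tris] by (simp add: h_def n_def t_def)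
    consider "sources = {}" | "sources = S" | "sources \<noteq> {}" "sources \<noteq> S" by blast
    thus ?thesis
    proof cases
      case 1
      \<comment> \<open>The hull boundary is in fact never empty. Instead of proving this,
        \<open>h = 0\<close> in \<open>touch\<close> forces \<open>t \<ge> 2 / 3 * (n + 6)\<close>,
        and Euler's formula then leaves few enough contacts.\<close>
      hence "h = 0" by (simp add: h_def)
      moreover have "0 \<le> real (card ?T) / 2" by simp
      ultimately have "e \<le> 7 / 3 * n - 7" using e touch by linarith
      thus ?thesis using contact_bound_sparse[of n] by (simp add: e_def n_def)
    next
      case 2
      \<comment> \<open>No point remains inside, where the induction hypothesis would ask for a
        nonempty set; Euler's formula with \<open>h = n\<close> suffices.\<close>
      hence "e \<le> 2 * n - 3" using e by (simp add: n_def h_def t_def)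
      thus ?thesis using contact_bound_outerplanar[OF n1] by (simp add: e_def n_def)
    next
      case 3
      define S' where "S' = S - sources"
      have S': "S' \<subseteq> S" "S' \<noteq> {}" using 3 sources_subset by (auto simp: S'_def)
      have card_S': "card S' = card S - card sources"
        unfolding S'_def by (rule card_Diff_subset[OF finite_sources sources_subset])
      have lt: "card S' < card S"
        by (rule psubset_card_mono[OF finite_S]) (use 3 sources_subset in \<open>auto simp: S'_def\<close>)
      have "finite S'" using S'(1) finite_S finite_subset by blast
      moreover have "\<And>u v. u \<in> S' \<Longrightarrow> v \<in> S' \<Longrightarrow> u \<noteq> v \<Longrightarrow> dist u v \<ge> side7" using S(3) S'(1) by blast
      ultimately have IH: "real (card (contact_darts S')) / 2 \<le> contact_bound (real (card S'))"
        using less.hyps[OF lt] S'(2) by blast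
      have split: "?G = contact_darts S' \<union> ?T" "contact_darts S' \<inter> ?T = {}"
        by (auto simp: contact_darts_def S'_def)
      have fin: "finite (contact_darts S')" "finite ?T"
        by (rule finite_subset[OF _ finite_G]; auto simp: contact_darts_def S'_def)+
      have "card ?G = card (contact_darts S') + card ?T"
        using arg_cong[OF split(1), of card] card_Un_disjoint[OF fin split(2)] by (rule trans)
      hence "e \<le> contact_bound (n - h) + 4 * h - n - 6 + 3 / 2 * t"
        using IH touch hn by (simp add: n_def h_def e_def card_S' of_nat_diff)
      moreover have "1 \<le> n - h"
      proof -
        have "card S' > 0" using S'(2) \<open>finite S'\<close> by (simp add: card_gt_0_iff)
        thus ?thesis using card_S' by (simp add: n_def h_def)
      qed
      ultimately have "e \<le> contact_bound n"
        by (intro contact_bound_step[OF _ _ _ _ e]) (use hn in \<open>auto simp: t_def h_def n_def\<close>)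
      thus ?thesis by (simp add: e_def n_def)
    qed
  qed
qed

lemma card_touching_pairs:
  assumes "circle_packing side7 S"
  shows "2 * card (touching_pairs side7 S) = card (contact_darts S)"
proof -
  define f where "f = (\<lambda>(p, q). {p, q :: hyp_plane})"
  have fin: "finite (contact_darts S)"
    by (rule finite_subset[of _ "S \<times> S"])
      (use assms in \<open>auto simp: contact_darts_def circle_packing_def\<close>)
  have img: "touching_pairs side7 S = f ` contact_darts S"
    unfolding touching_pairs_eq[OF assms]
  proof (intro set_eqI iffI)
    fix y assume "y \<in> {{p, q} | p q. p \<in> S \<and> q \<in> S \<and> p \<noteq> q \<and> dist p q = side7}"
    then obtain p q where "y = f (p, q)" "(p, q) \<in> contact_darts S"
      by (auto simp: f_def contact_darts_def)
    thus "y \<in> f ` contact_darts S" by (rule image_eqI)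
  next
    fix y assume "y \<in> f ` contact_darts S"
    then obtain p q where "y = {p, q}" "p \<in> S" "q \<in> S" "dist p q = side7"
      by (auto simp: f_def contact_darts_def)
    moreover then have "p \<noteq> q" using side7(1) by auto
    ultimately show "y \<in> {{p, q} | p q. p \<in> S \<and> q \<in> S \<and> p \<noteq> q \<and> dist p q = side7}" by blast
  qed
  have fibre: "card {d \<in> contact_darts S. f d = y} = 2" if y: "y \<in> f ` contact_darts S" for y
  proof -
    obtain d where "d \<in> contact_darts S" "y = f d" using y by blast
    then obtain p q where pq: "(p, q) \<in> contact_darts S" "y = {p, q}" by (cases d) (simp add: f_def)
    have d: "dist p q = side7" "p \<in> S" "q \<in> S" using pq(1) by (simp_all add: contact_darts_def)
    hence "p \<noteq> q" using side7(1) by auto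
    moreover have "(a, b) \<in> contact_darts S \<and> f (a, b) = y \<longleftrightarrow> (a, b) = (p, q) \<or> (a, b) = (q, p)" for a b
      using d dist_commute[of p q] by (auto simp: pq(2) f_def doubleton_eq_iff contact_darts_def)
    hence "{d \<in> contact_darts S. f d = y} = {(p, q), (q, p)}"
      unfolding set_eq_iff split_paired_All by simp
    ultimately show ?thesis by simp
  qed
  have "card (contact_darts S) = (\<Sum>y\<in>f ` contact_darts S. card {d \<in> contact_darts S. f d = y})"
    using sum.image_gen[OF fin, of "\<lambda>_. 1 :: nat" f] by simp
  also have "\<dots> = (\<Sum>y\<in>f ` contact_darts S. 2)" by (rule sum.cong[OF refl fibre])
  finally show ?thesis by (simp add: img)
qed

theorem mainTheorem2:
  fixes n :: nat
  assumes "n \<ge> 1"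
  shows "int (max_touching_pairs (equilateral_side (2 * pi / 7)) n)
           \<le> \<lfloor>7 / 2 * real n - sqrt (5 / 4 * (real n)\<^sup>2 + 15 * real n - 4)\<rfloor>"
proof -
  define M where "M = {card (touching_pairs side7 S) | S :: hyp_plane set. circle_packing side7 S \<and> card S = n}"
  have "finite M" "M \<noteq> {}"
    using max_touching_pairs_Max_proper[OF side7(1), of n] by (simp_all add: M_def)
  hence "max_touching_pairs side7 n \<in> M"
    unfolding max_touching_pairs_def M_def[symmetric] by (rule Max_in)
  then obtain S :: "hyp_plane set" where S: "circle_packing side7 S" "card S = n"
    and max: "max_touching_pairs side7 n = card (touching_pairs side7 S)"
    by (auto simp: M_def)
  have pack: "finite S" "\<And>u v. u \<in> S \<Longrightarrow> v \<in> S \<Longrightarrow> u \<noteq> v \<Longrightarrow> dist u v \<ge> side7"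
    using S(1) by (auto simp: circle_packing_iff)
  have "S \<noteq> {}" using S(2) assms by auto
  hence "real (card (contact_darts S)) / 2 \<le> contact_bound (real n)"
    using card_contact_darts_le[OF pack(1) _ pack(2)] S(2) by simp
  moreover have "real (card (contact_darts S)) = 2 * real (max_touching_pairs side7 n)"
    unfolding max card_touching_pairs[OF S(1), symmetric] by simp
  ultimately have "real (max_touching_pairs side7 n) \<le> contact_bound (real n)" by simp
  thus ?thesis
    unfolding side7_def contact_bound_def by (simp add: le_floor_iff)
qed

end
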